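(* Consider a discrete memoryless channel with noiseless, delay-free, infinite-capacity feedback, with capacity $C$, and let $0<R<C$. Let $g(a)=E_{\mathrm r}(a)/a$ and $$\alpha^{\ast}(R,\gamma):=\frac{R}{g^{-1}(\gamma/R)}.$$ Let $x,x'\in\mathcal X$ be two inputs maximizing $D(P_{Y|X}(\cdot|x)\|P_{Y|X}(\cdot|x'))$. For $\lambda\in[0,1]$ define the tilted distribution $$P^{(\lambda)}(y):=\frac{P_{Y|X}(y|x)^{1-\lambda}P_{Y|X}(y|x')^{\lambda}}{\sum_{a\in\mathcal Y}P_{Y|X}(a|x)^{1-\lambda}P_{Y|X}(a|x')^{\lambda}},\qquad y\in\mathcal Y.$$ Define $$E''_{\mathrm{ee}}(\alpha,\lambda,R):=\alpha E_{\mathrm r}\!\left(\frac R\alpha\right)+(1-\alpha)\,D\big(P^{(\lambda)}\|P_{Y|X}(\cdot|x')\big),$$ $$E'_{\mathrm{ee}}(R,\gamma):=\max_{\alpha\in[\alpha^{\ast}(R,\gamma),1]}\ \max_{\substack{\lambda\in[0,1]\\(1-\alpha)D(P^{(\lambda)}\|P_{Y|X}(\cdot|x))\ge\gamma}}E''_{\mathrm{ee}}(\alpha,\lambda,R).$$ Then for $0<\gamma<E_{\mathrm r}(R)$ and every $K\in\mathbb N$, $$\mathcal{E}_{\mathrm{AFLF}}(R,\gamma,K)\ \ge\ \min\left\{E'_{\mathrm{ee}}(R,\gamma),\ (K-1)E_{\mathrm r}\!\left(\frac{R}{K-1}\right)\right\}.$$ Additionally, for $\gamma>E_{\mathrm r}(R)$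 and every $K\in\mathbb N$, $\mathcal{E}_{\mathrm{AFLF}}(R,\gamma,K)\ge E_{\mathrm r}(R)$.
   Context: Channel: finite input alphabet $\mathcal X$, finite output alphabet $\mathcal Y$, transition law $P_{Y|X}$, with $P(Y_n=y_n\mid X_1^n=x_1^n,Y_1^{n-1}=y_1^{n-1})=P_{Y|X}(y_n|x_n)$ for all $n$. The transmitter observes $Y_1,\dots,Y_{n-1}$ before sending $X_n$. All logarithms are base 2; $D$ is the Kullback–Leibler divergence. Random coding exponent (Gallager): $E_{\mathrm r}(R)=\max_{0\le\rho\le1}\max_{Q}\{E_0(\rho,Q)-\rho R\}$, where $Q$ ranges over distributions on $\mathcal X$ and $E_0(\rho,Q)=-\log_2\sum_{y}\big(\sum_xQ(x)P_{Y|X}(y|x)^{1/(1+\rho)}\big)^{1+\rho}$. Thus $\alpha^{\ast}(R,\gamma)$ is the value of $\alpha$ with $\alpha E_{\mathrm r}(R/\alpha)=\gamma$ ($g$ is inverted on $(0,C)$). For $K=1$ the expression $(K-1)E_{\mathrm r}(R/(K-1))$ is read as $0$, and a maximum over an empty set is read as $-\infty$. AFLF code: for $\ell,M,K\in\mathbb N$, $\gamma\ge0$, $\epsilon\in(0,1)$, an $(\ell,M,\gamma,K,\epsilon)$ almost-fixed-length feedback (AFLF) code consists of (i) common randomness $U\sim P_U$ on a set $\mathcal U$, known to encoder and decoder before transmission; (ii) encoders $f_n:\mathcal U\times\{1,\dots,M\}\times\mathcal Y^{n-1}\to\mathcal X$, $n\in\mathbb N$, with $X_n=f_n(U,W,Y^{n-1})$,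 where the message $W$ is uniform on $\{1,\dots,M\}$; (iii) decoders $g_n:\mathcal U\times\mathcal Y^n\to\{1,\dots,M\}$, $n\in\mathbb N$; (iv) a random stopping time $\tau\in\mathbb N$ (determined by $U$ and the channel outputs observed so far) with $P(\tau>\ell)\le2^{-\gamma\ell}$ and $\tau\le K\ell$ almost surely, such that the final estimate $\hat W_\tau:=g_\tau(U,Y^\tau)$ satisfies $P(\hat W_\tau\ne W)\le\epsilon$. Achievability: $(R,E)$ is achievable in a $(\gamma,K)$-almost-fixed-length manner with feedback if for every $\delta>0$ there is $\ell(\delta)\in\mathbb N$ such that for all $\ell\ge\ell(\delta)$ there is an $(\ell,M_\ell,\gamma,K,\epsilon_\ell)$ AFLF code with $M_\ell\ge2^{\ell R}$ and $\epsilon_\ell\le2^{-\ell(E-\delta)}$. $\mathcal{E}_{\mathrm{AFLF}}(R,\gamma,K)$ is the largest (supremum) $E$ such that $(R,E)$ is achievable in this sense. *)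

theory Defs
  imports "HOL-Probability.Probability"
begin

text \<open>
  A discrete memoryless channel with finite input and output alphabets is a family
  \<open>P :: 'x \<Rightarrow> 'y pmf\<close> over finite types; \<open>P x\<close> is the law of the output for input \<open>x\<close>.
\<close>

section \<open>Information measures and exponents\<close>

definition capacity :: "('x::finite \<Rightarrow> 'y::finite pmf) \<Rightarrow> real" where
  "capacity P = (SUP Q :: 'x pmf.
     prob_space.mutual_information
       (measure_pmf (Q \<bind> (\<lambda>x. map_pmf (Pair x) (P x)))) 2
       (count_space UNIV) (count_space UNIV) fst snd)"

text \<open>
  The library's \<^const>\<open>KL_divergence\<close> is real-valued, takes the reference measure first, and is
  meaningful only under absolute continuity. \<open>kl_div N M\<close> is \<open>D(N || M)\<close> in bits, with value
  \<open>\<infinity>\<close> if \<open>N\<close> is not absolutely continuous with respect to \<open>M\<close>.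
\<close>

definition kl_div :: "'a measure \<Rightarrow> 'a measure \<Rightarrow> ereal" where
  "kl_div N M = (if absolutely_continuous M N then ereal (KL_divergence 2 M N) else \<infinity>)"

lemma kl_div_density:
  fixes f g :: "'y::finite \<Rightarrow> real"
  assumes f: "\<And>y. 0 \<le> f y" and g: "\<And>y. 0 \<le> g y"
  shows "kl_div (density (count_space UNIV) f) (density (count_space UNIV) g) =
    (if \<exists>y. g y = 0 \<and> f y \<noteq> 0 then \<infinity> else ereal (\<Sum>y\<in>UNIV. f y * log 2 (f y / g y)))"
proof -
  interpret S: sigma_finite_measure "count_space (UNIV::'y set)"
    by (rule sigma_finite_measure_count_space)
  have null: "A \<in> null_sets (density (count_space UNIV) (\<lambda>y. ennreal (h y))) \<longleftrightarrow> (\<forall>y\<in>A. h y = 0)"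
    if "\<And>y. 0 \<le> h y" for h :: "'y \<Rightarrow> real" and A
    using that by (auto simp: null_sets_density_iff AE_count_space ennreal_eq_0_iff order.antisym)
  have ac: "absolutely_continuous (density (count_space UNIV) g) (density (count_space UNIV) f)
    \<longleftrightarrow> (\<forall>y. g y = 0 \<longrightarrow> f y = 0)"
    unfolding absolutely_continuous_def subset_eq null[OF f] null[OF g] Ball_def[of "null_sets _"]
    by (metis null[OF f] null[OF g] insertCI singletonD)
  show ?thesis
  proof (cases "\<forall>y. g y = 0 \<longrightarrow> f y = 0")
    case True
    have "KL_divergence 2 (density (count_space UNIV) g) (density (count_space UNIV) f)
      = (\<integral>y. f y * log 2 (f y / g y) \<partial>count_space UNIV)"
      by (rule S.KL_density_density) (use f g True in \<open>auto simp: AE_count_space\<close>)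
    then show ?thesis using True ac by (auto simp: kl_div_def lebesgue_integral_count_space_finite)
  next
    case False then show ?thesis using ac by (auto simp: kl_div_def)
  qed
qed

definition gallager_E0 :: "('x::finite \<Rightarrow> 'y::finite pmf) \<Rightarrow> real \<Rightarrow> 'x pmf \<Rightarrow> real" where
  "gallager_E0 P \<rho> Q =
     - log 2 (\<Sum>y\<in>UNIV. (\<Sum>x\<in>UNIV. pmf Q x * pmf (P x) y powr (1 / (1 + \<rho>))) powr (1 + \<rho>))"

definition random_coding_exponent :: "('x::finite \<Rightarrow> 'y::finite pmf) \<Rightarrow> real \<Rightarrow> real" where
  "random_coding_exponent P R = (SUP \<rho>\<in>{0..1}. SUP Q. gallager_E0 P \<rho> Q - \<rho> * R)"

definition alpha_star :: "('x::finite \<Rightarrow> 'y::finite pmf) \<Rightarrow> real \<Rightarrow> real \<Rightarrow> real" where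
  "alpha_star P R \<gamma> =
     R / the_inv_into {0<..<capacity P} (\<lambda>a. random_coding_exponent P a / a) (\<gamma> / R)"

text \<open>
  Powers of probabilities follow the convention \<open>0\<^sup>0 = 1\<close>, whereas \<open>0 powr 0 = 0\<close>. The
  tilted law with parameter \<open>s\<close> therefore equals \<open>P x\<close> at \<open>s = 0\<close> and \<open>P x'\<close> at \<open>s = 1\<close>, also
  when the two supports differ.
\<close>

definition prob_powr :: "real \<Rightarrow> real \<Rightarrow> real" where
  "prob_powr p s = (if s = 0 then 1 else p powr s)"

definition tilted_density ::
  "('x \<Rightarrow> 'y::finite pmf) \<Rightarrow> 'x \<Rightarrow> 'x \<Rightarrow> real \<Rightarrow> 'y \<Rightarrow> real" where
  "tilted_density P x x' s y =
     prob_powr (pmf (P x) y) (1 - s) * prob_powr (pmf (P x') y) s /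
     (\<Sum>a\<in>UNIV. prob_powr (pmf (P x) a) (1 - s) * prob_powr (pmf (P x') a) s)"

lemma tilted_density_endpoints:
  "tilted_density P x x' 0 = pmf (P x)" "tilted_density P x x' 1 = pmf (P x')"
  by (auto simp: fun_eq_iff tilted_density_def prob_powr_def sum_pmf_eq_1)

text \<open>
  If the supports of \<open>P x\<close> and \<open>P x'\<close> are disjoint and \<open>0 < s < 1\<close>, the normalizer vanishes
  and the following is the null measure, whose divergences are \<open>0\<close>; such \<open>s\<close> then violate the
  constraint in \<open>E_ee'\<close> below for every \<open>\<gamma> > 0\<close>.
\<close>

definition tilted :: "('x \<Rightarrow> 'y::finite pmf) \<Rightarrow> 'x \<Rightarrow> 'x \<Rightarrow> real \<Rightarrow> 'y measure" where
  "tilted P x x' s = density (count_space UNIV) (\<lambda>y. ennreal (tilted_density P x x' s y))"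

definition E_ee'' ::
  "('x::finite \<Rightarrow> 'y::finite pmf) \<Rightarrow> 'x \<Rightarrow> 'x \<Rightarrow> real \<Rightarrow> real \<Rightarrow> real \<Rightarrow> ereal" where
  "E_ee'' P x x' \<alpha> s R =
     ereal (\<alpha> * random_coding_exponent P (R / \<alpha>)) +
     ereal (1 - \<alpha>) * kl_div (tilted P x x' s) (measure_pmf (P x'))"

definition E_ee' ::
  "('x::finite \<Rightarrow> 'y::finite pmf) \<Rightarrow> 'x \<Rightarrow> 'x \<Rightarrow> real \<Rightarrow> real \<Rightarrow> ereal" where
  "E_ee' P x x' R \<gamma> =
     (SUP \<alpha>\<in>{alpha_star P R \<gamma>..1}.
        SUP s\<in>{s\<in>{0..1}. ereal (1 - \<alpha>) * kl_div (tilted P x x' s) (measure_pmf (P x)) \<ge> ereal \<gamma>}.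
          E_ee'' P x x' \<alpha> s R)"


section \<open>Almost-fixed-length feedback codes\<close>

text \<open>
  The encoder \<open>f\<^sub>n\<close> and the decoder \<open>g\<^sub>n\<close> are recovered from the length of the list of channel
  outputs: \<open>f\<^sub>n(u,w,y\<^sup>n\<^sup>-\<^sup>1)\<close> is \<open>enc c u w ys\<close> with \<open>length ys = n - 1\<close> and \<open>g\<^sub>n(u,y\<^sup>n)\<close> is
  \<open>dec c u ys\<close> with \<open>length ys = n\<close>. The stopping time is the least \<open>n \<ge> 1\<close> such that \<open>halt c u\<close>
  holds of the first \<open>n\<close> outputs. HOL cannot quantify over types inside a formula, so the common
  randomness lives on a subset of the reals, with an arbitrary sigma-algebra and law.
\<close>

record ('x, 'y) feedback_code =
  common :: "real measure"
  enc :: "real \<Rightarrow> nat \<Rightarrow> 'y list \<Rightarrow> 'x"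
  dec :: "real \<Rightarrow> 'y list \<Rightarrow> nat"
  halt :: "real \<Rightarrow> 'y list \<Rightarrow> bool"

definition halted :: "('x, 'y) feedback_code \<Rightarrow> real \<Rightarrow> 'y list \<Rightarrow> bool" where
  "halted c u ys \<longleftrightarrow> (\<exists>n\<in>{1..length ys}. halt c u (take n ys))"

definition stop_time :: "('x, 'y) feedback_code \<Rightarrow> real \<Rightarrow> 'y list \<Rightarrow> nat" where
  "stop_time c u ys = (LEAST n. 1 \<le> n \<and> halt c u (take n ys))"

text \<open>
  Law of \<open>Y\<^sub>1, \<dots>, Y\<^sub>n\<close> when the next input is \<open>\<phi>\<close> applied to the outputs observed so far.
\<close>

primrec outputs :: "('x \<Rightarrow> 'y pmf) \<Rightarrow> ('y list \<Rightarrow> 'x) \<Rightarrow> nat \<Rightarrow> 'y list pmf" where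
  "outputs P \<phi> 0 = return_pmf []"
| "outputs P \<phi> (Suc n) = outputs P \<phi> n \<bind> (\<lambda>ys. map_pmf (\<lambda>y. ys @ [y]) (P (\<phi> ys)))"

text \<open>
  \<open>code_prob P c M n A\<close> is the probability of \<open>A U W Y\<^sup>n\<close>, where \<open>U\<close> has law \<open>common c\<close>, and
  \<open>W\<close> is uniform on \<open>{1..M}\<close> and independent of \<open>U\<close>.
\<close>

definition code_prob ::
  "('x \<Rightarrow> 'y pmf) \<Rightarrow> ('x, 'y) feedback_code \<Rightarrow> nat \<Rightarrow> nat \<Rightarrow> (real \<Rightarrow> nat \<Rightarrow> 'y list \<Rightarrow> bool) \<Rightarrow> real"
  where
  "code_prob P c M n A =
     (\<integral>u. measure_pmf.prob
            (pmf_of_set {1..M} \<bind> (\<lambda>w. map_pmf (Pair w) (outputs P (enc c u w) n)))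
            {(w, ys). A u w ys} \<partial>common c)"

text \<open>
  Since \<open>{\<tau> > n}\<close> is determined by \<open>U\<close> and \<open>Y\<^sup>n\<close>, its probability is evaluated on the first \<open>n\<close>
  outputs. As \<open>\<tau> \<le> K\<ell>\<close> almost surely, the final estimate is evaluated on the first \<open>K\<ell>\<close> outputs.
\<close>

definition aflf_code ::
  "('x::finite \<Rightarrow> 'y::finite pmf) \<Rightarrow> nat \<Rightarrow> nat \<Rightarrow> real \<Rightarrow> nat \<Rightarrow> real \<Rightarrow> ('x, 'y) feedback_code \<Rightarrow> bool"
  where
  "aflf_code P l M \<gamma> K \<epsilon> c \<longleftrightarrow>
     1 \<le> l \<and> 1 \<le> M \<and> 1 \<le> K \<and> 0 \<le> \<gamma> \<and> 0 < \<epsilon> \<and> \<epsilon> < 1 \<and>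
     prob_space (common c) \<and>
     (\<forall>w\<in>{1..M}. \<forall>ys. (\<lambda>u. enc c u w ys) \<in> measurable (common c) (count_space UNIV)) \<and>
     (\<forall>ys. (\<lambda>u. dec c u ys) \<in> measurable (common c) (count_space UNIV)) \<and>
     (\<forall>ys. (\<lambda>u. halt c u ys) \<in> measurable (common c) (count_space UNIV)) \<and>
     (\<forall>u\<in>space (common c). \<forall>ys. ys \<noteq> [] \<longrightarrow> dec c u ys \<in> {1..M}) \<and>
     code_prob P c M l (\<lambda>u w ys. \<not> halted c u ys) \<le> 2 powr (- \<gamma> * real l) \<and>
     code_prob P c M (K * l) (\<lambda>u w ys. \<not> halted c u ys) = 0 \<and>
     code_prob P c M (K * l) (\<lambda>u w ys. dec c u (take (stop_time c u ys) ys) \<noteq> w) \<le> \<epsilon>"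

definition aflf_achievable ::
  "('x::finite \<Rightarrow> 'y::finite pmf) \<Rightarrow> real \<Rightarrow> real \<Rightarrow> real \<Rightarrow> nat \<Rightarrow> bool" where
  "aflf_achievable P R E \<gamma> K \<longleftrightarrow>
     (\<forall>\<delta>>0. \<exists>l\<^sub>0\<ge>1. \<forall>l\<ge>l\<^sub>0. \<exists>M \<epsilon> c.
        aflf_code P l M \<gamma> K \<epsilon> c \<and>
        real M \<ge> 2 powr (real l * R) \<and>
        \<epsilon> \<le> 2 powr (- real l * (E - \<delta>)))"

definition E_AFLF :: "('x::finite \<Rightarrow> 'y::finite pmf) \<Rightarrow> real \<Rightarrow> real \<Rightarrow> nat \<Rightarrow> ereal" where
  "E_AFLF P R \<gamma> K = Sup {ereal E | E. aflf_achievable P R E \<gamma> K}"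

end

theory Submission
  imports Defs
begin

text \<open>
  For \<open>K \<ge> 2\<close> the code sends the message with a random block code during about \<open>\<alpha>\<ell>\<close> channel uses.
  Knowing the decoder's tentative decision through the feedback, the encoder spends the rest of the
  first \<open>\<ell>\<close> uses on repeating \<open>x\<close> if the decision is right and \<open>x'\<close> if it is wrong. The decoder
  distinguishes the two by a likelihood ratio test. If it accepts \<open>x\<close> it stops at time \<open>\<ell>\<close>;
  otherwise the message is sent afresh with a block code of length \<open>(K - 1)\<ell>\<close>. Continuing beyond
  \<open>\<ell>\<close> requires a first-phase error or a type I error; a wrong final estimate requires both a
  first-phase error and a type II error, or an error of the last block code. If \<open>K = 1\<close> or the
  tilting parameter is \<open>1\<close>, a block code of length \<open>\<ell>\<close> is already good enough.
\<close>

section \<open>Mutual information and the random coding exponent\<close>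

text \<open>The condition \<alpha> \<ge> \<open>alpha_star\<close> amounts to \<alpha>
  E_r(R/\<alpha>) \<ge> \<gamma>, because this expression is nondecreasing in \<alpha> and equals
  \<gamma> at \<open>alpha_star\<close>; the condition on the tilting parameter says the same of the
  type I exponent. Both may hold with equality, yet the bound 2^(-\<gamma> l) on continuing must
  hold exactly, with no \<delta> to spare, for a sum of two terms and for integer lengths. The
  missing slack is taken from the error exponent, which may be any e below the target: the first
  phase is lengthened a little and the threshold of the test is raised a little. Before that change
  the threshold is the mean log-likelihood ratio under the tilted law; the Chernoff bounds with tilt
  s then have the divergences in \<open>E_ee'\<close> and \<open>E_ee''\<close> as their exponents.
  Maxima are approached by near-optimal parameters instead of being attained. Capacity enters
  through E_0 \<le> \<rho> C, which keeps the suprema over the reals bounded and forces E_r(a)/a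
  down near C, so that \<open>alpha_star\<close> really inverts it at \<gamma>/R.\<close>

lemma exp_sum_le_sum_exp:
  fixes a z :: "'i \<Rightarrow> real"
  assumes "\<And>i. i \<in> I \<Longrightarrow> 0 \<le> a i" and sum1: "sum a I = 1"
  shows "exp (\<Sum>i\<in>I. a i * z i) \<le> (\<Sum>i\<in>I. a i * exp (z i))"
proof -
  define m where "m = (\<Sum>i\<in>I. a i * z i)"
  \<comment> \<open>The tangent of \<open>exp\<close> at the mean m lies below \<open>exp\<close>;
    averaging the tangents makes the linear term vanish.\<close>
  have "exp m * (1 + (z i - m)) \<le> exp (z i)" for i
    using mult_left_mono[OF exp_ge_add_one_self[of "z i - m"], of "exp m"]
    by (simp add: exp_diff)
  then have "(\<Sum>i\<in>I. a i * (exp m * (1 + (z i - m)))) \<le> (\<Sum>i\<in>I. a i * exp (z i))"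
    using assms by (intro sum_mono mult_left_mono) auto
  moreover have "(\<Sum>i\<in>I. a i * (exp m * (1 + (z i - m))))
      = exp m * ((1 - m) * sum a I + (\<Sum>i\<in>I. a i * z i))"
    by (simp add: algebra_simps sum.distrib sum_subtractf sum_distrib_left)
  ultimately show ?thesis using sum1 by (simp add: m_def)
qed

text \<open>Jensen for the concave power \<rho>. Young's inequality, scaled by the mean m, bounds
  each power by its tangent at m, and the linear terms average out.\<close>

lemma sum_powr_le_powr_sum:
  fixes a z :: "'i \<Rightarrow> real"
  assumes "finite I" and a: "\<And>i. i \<in> I \<Longrightarrow> 0 \<le> a i" and sum1: "sum a I = 1"
    and z: "\<And>i. i \<in> I \<Longrightarrow> 0 \<le> z i" and \<rho>: "0 \<le> \<rho>" "\<rho> \<le> 1"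
  shows "(\<Sum>i\<in>I. a i * z i powr \<rho>) \<le> (\<Sum>i\<in>I. a i * z i) powr \<rho>"
proof (cases "(\<Sum>i\<in>I. a i * z i) = 0")
  case True
  then have "\<forall>i\<in>I. a i * z i = 0"
    using assms by (subst (asm) sum_nonneg_eq_0_iff) auto
  then have "(\<Sum>i\<in>I. a i * z i powr \<rho>) = 0" by (intro sum.neutral) auto
  then show ?thesis by simp
next
  case False
  define m where "m = (\<Sum>i\<in>I. a i * z i)"
  have m: "0 < m"
    using False a z sum_nonneg[of I "\<lambda>i. a i * z i"] by (simp add: m_def less_le)
  have "z i powr \<rho> \<le> m powr \<rho> * (\<rho> * (z i / m) + (1 - \<rho>))" if "i \<in> I" for i
  proof (cases "z i = 0")
    case False
    with z[OF that] have "0 < z i" by simp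
    with m \<rho> have "(z i / m) powr \<rho> * 1 powr (1 - \<rho>) \<le> \<rho> * (z i / m) + (1 - \<rho>) * 1"
      by (intro Youngs_inequality_0) auto
    then show ?thesis using m \<open>0 < z i\<close> by (simp add: powr_divide field_simps)
  qed (use \<rho> in simp)
  then have "(\<Sum>i\<in>I. a i * z i powr \<rho>) \<le> (\<Sum>i\<in>I. a i * (m powr \<rho> * (\<rho> * (z i / m) + (1 - \<rho>))))"
    using a by (intro sum_mono mult_left_mono) auto
  also have "\<dots> = m powr \<rho> * (\<rho> * (\<Sum>i\<in>I. a i * z i) / m + (1 - \<rho>) * sum a I)"
    by (simp add: algebra_simps sum.distrib sum_subtractf sum_distrib_left sum_distrib_right sum_divide_distrib)
  also have "\<dots> = m powr \<rho>" using m sum1 by (simp flip: m_def)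
  finally show ?thesis by (simp add: m_def)
qed

section \<open>Channel information and capacity\<close>

definition output_pmf :: "('x::finite \<Rightarrow> 'y::finite pmf) \<Rightarrow> 'x pmf \<Rightarrow> 'y \<Rightarrow> real" where
  "output_pmf P Q y = (\<Sum>x\<in>UNIV. pmf Q x * pmf (P x) y)"

lemma output_pmf_nonneg: "0 \<le> output_pmf P Q y"
  by (simp add: output_pmf_def sum_nonneg)

lemma sum_output_pmf: "(\<Sum>y\<in>UNIV. output_pmf P Q y) = 1"
  unfolding output_pmf_def
  by (subst sum.swap) (simp add: sum_pmf_eq_1 flip: sum_distrib_left)

definition channel_information :: "('x::finite \<Rightarrow> 'y::finite pmf) \<Rightarrow> 'x pmf \<Rightarrow> real" where
  "channel_information P Q =
     (\<Sum>x\<in>UNIV. \<Sum>y\<in>UNIV. pmf Q x * pmf (P x) y * log 2 (pmf (P x) y / output_pmf P Q y))"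

lemma mutual_information_eq_channel_information:
  fixes P :: "'x::finite \<Rightarrow> 'y::finite pmf"
  shows "prob_space.mutual_information
       (measure_pmf (Q \<bind> (\<lambda>x. map_pmf (Pair x) (P x)))) 2
       (count_space UNIV) (count_space UNIV) fst snd = channel_information P Q"
proof -
  define J where "J = Q \<bind> (\<lambda>x. map_pmf (Pair x) (P x))"
  interpret information_space "measure_pmf J" 2
    by unfold_locales simp
  have J: "pmf J (x, y) = pmf Q x * pmf (P x) y" for x y
  proof -
    have "pmf (map_pmf (Pair x') (P x')) (x, y) = (if x' = x then pmf (P x) y else 0)" for x'
    proof (cases "x' = x")
      case True
      then show ?thesis using pmf_map_inj'[of "Pair x'" "P x'" y] by (simp add: inj_on_def)
    next
      case False
      then show ?thesis by (subst pmf_map_outside) auto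
    qed
    then have "pmf J (x, y) = (\<Sum>x'\<in>UNIV. (if x' = x then pmf (P x) y else 0) * pmf Q x')"
      unfolding J_def by (subst pmf_bind, subst integral_measure_pmf_real[where A=UNIV]) auto
    also have "\<dots> = (\<Sum>x'\<in>UNIV. if x' = x then pmf (P x) y * pmf Q x' else 0)"
      by (intro sum.cong) auto
    finally show ?thesis by simp
  qed
  have fst: "map_pmf fst J = Q"
    by (simp add: J_def map_bind_pmf pmf.map_comp o_def bind_return_pmf')
  have snd: "pmf (map_pmf snd J) y = output_pmf P Q y" for y
    by (simp add: J_def map_bind_pmf pmf.map_comp o_def pmf_bind output_pmf_def mult.commute
       integral_measure_pmf_real[where A=UNIV])
  have dist: "distributed (measure_pmf J) (count_space UNIV) X (pmf (map_pmf X J))"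
    for X :: "'x \<times> 'y \<Rightarrow> 'a"
    unfolding distributed_def by (simp flip: map_pmf_rep_eq measure_pmf_eq_density)
  have UU: "count_space (UNIV::'x set) \<Otimes>\<^sub>M count_space (UNIV::'y set) = count_space UNIV"
    by (simp add: pair_measure_count_space)
  have "prob_space.mutual_information (measure_pmf J) 2 (count_space UNIV) (count_space UNIV) fst snd =
     (\<integral>x. pmf (map_pmf (\<lambda>x. (fst x, snd x)) J) x * log 2 (pmf (map_pmf (\<lambda>x. (fst x, snd x)) J) x /
       (pmf (map_pmf fst J) (fst x) * pmf (map_pmf snd J) (snd x)))
      \<partial>(count_space (UNIV::'x set) \<Otimes>\<^sub>M count_space (UNIV::'y set)))"
    by (rule mutual_information_distr)
      (use dist[of "\<lambda>x. x"] in \<open>auto simp: UU pmf.map_ident intro!: dist sigma_finite_measure_count_space_finite\<close>)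
  also have "\<dots> = (\<Sum>(x, y)\<in>UNIV. pmf J (x, y) * log 2 (pmf J (x, y) / (pmf Q x * output_pmf P Q y)))"
    unfolding UU by (subst lebesgue_integral_count_space_finite) (auto simp: fst snd case_prod_beta)
  also have "\<dots> = channel_information P Q"
    unfolding channel_information_def sum.cartesian_product J
    by (auto intro!: sum.cong)
  finally show ?thesis unfolding J_def .
qed

text \<open>A crude bound whose purpose is that the supremum in \<open>capacity\<close> is over a
  bounded set. Since \<open>pmf (P x) y\<close> \<le> 1, the information is at most the output
  entropy, and each entropy term v log(1/v) is at most 1 / ln 2 \<le> 2.\<close>

lemma channel_information_le_card:
  fixes P :: "'x::finite \<Rightarrow> 'y::finite pmf"
  shows "channel_information P Q \<le> 2 * real CARD('y)"
proof -
  have pos: "0 < output_pmf P Q y" if "pmf Q x * pmf (P x) y \<noteq> 0" for x y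
  proof -
    have "pmf Q x * pmf (P x) y \<le> output_pmf P Q y"
      unfolding output_pmf_def by (rule member_le_sum) auto
    then show ?thesis using that pmf_nonneg[of Q x] pmf_nonneg[of "P x" y]
      by (smt (verit) mult_nonneg_nonneg)
  qed
  have "channel_information P Q \<le>
      (\<Sum>x\<in>UNIV. \<Sum>y\<in>UNIV. pmf Q x * pmf (P x) y * log 2 (1 / output_pmf P Q y))"
    unfolding channel_information_def
  proof (intro sum_mono)
    fix x :: 'x and y :: 'y
    show "pmf Q x * pmf (P x) y * log 2 (pmf (P x) y / output_pmf P Q y)
      \<le> pmf Q x * pmf (P x) y * log 2 (1 / output_pmf P Q y)"
    proof (cases "pmf Q x * pmf (P x) y = 0")
      case False
      then have "0 < pmf (P x) y" by (simp add: pmf_pos)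
      then show ?thesis using pos[OF False]
        by (intro mult_left_mono) (auto simp: divide_right_mono pmf_le_1)
    qed auto
  qed
  also have "\<dots> = (\<Sum>y\<in>UNIV. output_pmf P Q y * log 2 (1 / output_pmf P Q y))"
    by (subst sum.swap) (simp add: output_pmf_def sum_distrib_right)
  also have "\<dots> \<le> (\<Sum>y\<in>(UNIV::'y set). 2)"
  proof (intro sum_mono)
    fix y
    show "output_pmf P Q y * log 2 (1 / output_pmf P Q y) \<le> 2"
    proof (cases "output_pmf P Q y = 0")
      case False
      then have v: "0 < output_pmf P Q y" using output_pmf_nonneg[of P Q y] by simp
      have "ln (1 / output_pmf P Q y) \<le> 1 / output_pmf P Q y - 1"
        using v by (intro ln_le_minus_one) auto
      then have "output_pmf P Q y * ln (1 / output_pmf P Q y) \<le> 1"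
        using v mult_left_mono[of _ _ "output_pmf P Q y"] by (fastforce simp: right_diff_distrib)
      moreover have "1 / 2 \<le> ln (2::real)" using ln2_ge_two_thirds by simp
      ultimately show ?thesis
        using v by (simp add: log_def divide_simps)
    qed simp
  qed
  finally show ?thesis by simp
qed

lemma channel_information_le_capacity: "channel_information P Q \<le> capacity P"
  unfolding capacity_def mutual_information_eq_channel_information
  by (intro cSUP_upper bdd_aboveI2[where M="2 * real CARD('b)"] channel_information_le_card) auto

section \<open>Gallager's function: sign and comparison with capacity\<close>

lemma sum_powr_pmf_pos:
  fixes P :: "'x::finite \<Rightarrow> 'y::finite pmf"
  shows "0 < (\<Sum>y\<in>UNIV. (\<Sum>x\<in>UNIV. pmf Q x * pmf (P x) y powr t) powr r)"
proof -
  obtain x where x: "x \<in> set_pmf Q" using set_pmf_not_empty by fast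
  obtain y where y: "y \<in> set_pmf (P x)" using set_pmf_not_empty by fast
  have "0 < pmf Q x * pmf (P x) y powr t" using x y by (simp add: pmf_positive_iff pmf_pos set_pmf_iff)
  also have "\<dots> \<le> (\<Sum>x\<in>UNIV. pmf Q x * pmf (P x) y powr t)"
    by (rule member_le_sum) auto
  finally have "0 < (\<Sum>x\<in>UNIV. pmf Q x * pmf (P x) y powr t) powr r" by simp
  also have "\<dots> \<le> (\<Sum>y\<in>UNIV. (\<Sum>x\<in>UNIV. pmf Q x * pmf (P x) y powr t) powr r)"
    by (rule member_le_sum) auto
  finally show ?thesis .
qed

lemma two_powr_gallager_E0:
  "2 powr (- gallager_E0 P \<rho> Q) =
     (\<Sum>y\<in>UNIV. (\<Sum>x\<in>UNIV. pmf Q x * pmf (P x) y powr (1 / (1 + \<rho>))) powr (1 + \<rho>))"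
  unfolding gallager_E0_def using sum_powr_pmf_pos[of Q P "1 / (1 + \<rho>)" "1 + \<rho>"]
  by simp

text \<open>
  Two applications of Jensen's inequality for \<open>exp\<close>: first for the posterior law of the input
  given the output \<open>y\<close>, then for the law of the output.
\<close>

lemma gallager_E0_le_information:
  fixes P :: "'x::finite \<Rightarrow> 'y::finite pmf"
  assumes "0 \<le> \<rho>"
  shows "gallager_E0 P \<rho> Q \<le> \<rho> * channel_information P Q"
proof -
  define V where "V = output_pmf P Q"
  define W where "W y x = pmf Q x * pmf (P x) y / V y" for y x
  define A where "A y = (\<Sum>x\<in>UNIV. pmf Q x * pmf (P x) y powr (1 / (1 + \<rho>)))" for y
  define J where "J y = (\<Sum>x\<in>UNIV. W y x * ln (pmf (P x) y / V y))" for y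
  have V0: "0 \<le> V y" for y by (simp add: V_def output_pmf_nonneg)
  have QP0: "pmf Q x * pmf (P x) y = 0" if "V y = 0" for x y
    using that unfolding V_def output_pmf_def by (subst (asm) sum_nonneg_eq_0_iff) auto
  have A_ge: "V y * exp (- \<rho> * J y) \<le> A y powr (1 + \<rho>)" for y
  proof (cases "V y = 0")
    case False
    with V0[of y] have V: "0 < V y" by simp
    have W1: "(\<Sum>x\<in>UNIV. W y x) = 1"
      using V by (simp add: W_def V_def output_pmf_def flip: sum_divide_distrib)
    \<comment> \<open>The exponent is chosen so that \<open>pmf (P x) y * exp (z x)\<close> is the
      power 1/(1+\<rho>) of \<open>pmf (P x) y\<close>. Raising to 1+\<rho> afterwards turns the
      posterior mean of z into the term -\<rho> J of the exponent.\<close>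
    define z where "z x = - (\<rho> / (1 + \<rho>)) * ln (pmf (P x) y)" for x
    have "exp (\<Sum>x\<in>UNIV. W y x * z x) \<le> (\<Sum>x\<in>UNIV. W y x * exp (z x))"
      using V W1 by (intro exp_sum_le_sum_exp) (auto simp: W_def)
    also have "\<dots> = A y / V y"
    proof -
      have "W y x * exp (z x) = pmf Q x * pmf (P x) y powr (1 / (1 + \<rho>)) / V y" for x
      proof (cases "pmf (P x) y = 0")
        case False
        then have p: "0 < pmf (P x) y" by (simp add: pmf_pos)
        have "pmf (P x) y * exp (z x) = exp (ln (pmf (P x) y) + z x)"
          using p by (simp add: exp_add)
        also have "ln (pmf (P x) y) + z x = 1 / (1 + \<rho>) * ln (pmf (P x) y)"
          using assms by (simp add: z_def field_simps)
        finally show ?thesis using p by (simp add: W_def powr_def)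
      qed (simp add: W_def)
      then show ?thesis by (simp add: A_def sum_divide_distrib)
    qed
    finally have "V y * exp (\<Sum>x\<in>UNIV. W y x * z x) \<le> A y"
      using V by (simp add: field_simps)
    then have "(V y * exp (\<Sum>x\<in>UNIV. W y x * z x)) powr (1 + \<rho>) \<le> A y powr (1 + \<rho>)"
      using V assms by (intro powr_mono2) auto
    moreover have "(V y * exp (\<Sum>x\<in>UNIV. W y x * z x)) powr (1 + \<rho>)
       = exp ((1 + \<rho>) * (ln (V y) + (\<Sum>x\<in>UNIV. W y x * z x)))"
      using V by (simp add: powr_def ln_mult)
    moreover have "(1 + \<rho>) * (ln (V y) + (\<Sum>x\<in>UNIV. W y x * z x)) = ln (V y) - \<rho> * J y"
    proof -
      have "(1 + \<rho>) * (\<Sum>x\<in>UNIV. W y x * z x) = - \<rho> * (\<Sum>x\<in>UNIV. W y x * ln (pmf (P x) y))"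
        unfolding sum_distrib_left
      proof (intro sum.cong refl)
        fix x
        show "(1 + \<rho>) * (W y x * z x) = - \<rho> * (W y x * ln (pmf (P x) y))"
          using assms by (simp add: z_def divide_simps)
      qed
      moreover have "J y = (\<Sum>x\<in>UNIV. W y x * ln (pmf (P x) y)) - (\<Sum>x\<in>UNIV. W y x) * ln (V y)"
      proof -
        have "W y x * ln (pmf (P x) y / V y) = W y x * ln (pmf (P x) y) - W y x * ln (V y)" for x
          using V by (cases "pmf (P x) y = 0") (auto simp: W_def ln_div right_diff_distrib pmf_pos)
        then show ?thesis by (simp add: J_def sum_subtractf sum_distrib_right)
      qed
      ultimately show ?thesis using W1
        by (simp only: distrib_left right_diff_distrib mult_1 distrib_right)
    qed
    ultimately have "exp (ln (V y) - \<rho> * J y) \<le> A y powr (1 + \<rho>)" by metis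
    then show ?thesis using V by (simp add: exp_diff exp_minus divide_inverse)
  qed auto
  have "exp (\<Sum>y\<in>UNIV. V y * (- \<rho> * J y)) \<le> (\<Sum>y\<in>UNIV. V y * exp (- \<rho> * J y))"
    using V0 by (intro exp_sum_le_sum_exp) (auto simp: V_def sum_output_pmf)
  also have "\<dots> \<le> (\<Sum>y\<in>UNIV. A y powr (1 + \<rho>))"
    by (intro sum_mono A_ge)
  also have "\<dots> = 2 powr (- gallager_E0 P \<rho> Q)"
    by (simp add: two_powr_gallager_E0 A_def)
  also have "(\<Sum>y\<in>UNIV. V y * (- \<rho> * J y)) = - (\<rho> * channel_information P Q) * ln 2"
  proof -
    \<comment> \<open>Outputs with V y = 0 contribute 0 on both sides, by \<open>QP0\<close> on the
      right. The factor \<open>ln 2\<close> is the change from natural logarithms to bits.\<close>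
    have "V y * J y = (\<Sum>x\<in>UNIV. pmf Q x * pmf (P x) y * log 2 (pmf (P x) y / V y)) * ln 2" for y
      using QP0[of y] unfolding J_def W_def log_def
      by (auto simp: sum_distrib_left sum_distrib_right intro!: sum.cong)
    then have "(\<Sum>y\<in>UNIV. V y * J y) = channel_information P Q * ln 2"
      unfolding channel_information_def V_def
      by (subst sum.swap) (simp add: sum_distrib_right)
    then have "- \<rho> * (\<Sum>y\<in>UNIV. V y * J y) = - (\<rho> * channel_information P Q) * ln 2" by simp
    then show ?thesis by (simp add: sum_distrib_left algebra_simps sum_negf)
  qed
  finally show ?thesis by (simp add: powr_def)
qed

text \<open>Jensen for the power 1/(1+\<rho>) replaces the inner sum by a power of the output
  probability, and those probabilities add up to 1. Nonnegativity later makes rounding a block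
  length up harmless.\<close>

lemma gallager_E0_nonneg:
  fixes P :: "'x::finite \<Rightarrow> 'y::finite pmf"
  assumes "0 \<le> \<rho>"
  shows "0 \<le> gallager_E0 P \<rho> Q"
proof -
  have "(\<Sum>y\<in>UNIV. (\<Sum>x\<in>UNIV. pmf Q x * pmf (P x) y powr (1 / (1 + \<rho>))) powr (1 + \<rho>))
      \<le> (\<Sum>y\<in>UNIV. output_pmf P Q y)"
  proof (intro sum_mono)
    fix y
    have "(\<Sum>x\<in>UNIV. pmf Q x * pmf (P x) y powr (1 / (1 + \<rho>))) \<le> output_pmf P Q y powr (1 / (1 + \<rho>))"
      unfolding output_pmf_def using assms
      by (intro sum_powr_le_powr_sum) (auto simp: sum_pmf_eq_1)
    then have "(\<Sum>x\<in>UNIV. pmf Q x * pmf (P x) y powr (1 / (1 + \<rho>))) powr (1 + \<rho>)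
        \<le> (output_pmf P Q y powr (1 / (1 + \<rho>))) powr (1 + \<rho>)"
      using assms by (intro powr_mono2) (auto intro!: sum_nonneg)
    also have "\<dots> = output_pmf P Q y"
      using assms output_pmf_nonneg[of P Q y] by (simp add: powr_powr)
    finally show "(\<Sum>x\<in>UNIV. pmf Q x * pmf (P x) y powr (1 / (1 + \<rho>))) powr (1 + \<rho>)
        \<le> output_pmf P Q y" .
  qed
  then have "2 powr (- gallager_E0 P \<rho> Q) \<le> 2 powr 0"
    by (simp add: two_powr_gallager_E0 sum_output_pmf)
  then show ?thesis by (subst (asm) powr_le_cancel_iff) auto
qed

lemma gallager_E0_le_capacity:
  assumes "0 \<le> \<rho>"
  shows "gallager_E0 P \<rho> Q \<le> \<rho> * capacity P"
  using gallager_E0_le_information[OF assms, of P Q]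
    mult_left_mono[OF channel_information_le_capacity assms, of P Q] by linarith

lemma gallager_E0_0: "gallager_E0 P 0 Q = 0"
  using gallager_E0_nonneg[of 0 P Q] gallager_E0_le_capacity[of 0 P Q] by simp

section \<open>The random coding exponent as a function of the rate\<close>

lemma gallager_exponent_bdd: "bdd_above (range (\<lambda>Q. gallager_E0 P \<rho> Q - \<rho> * R))" if "0 \<le> \<rho>"
  by (rule bdd_aboveI2[where M="\<rho> * capacity P - \<rho> * R"]) (simp add: gallager_E0_le_capacity that)

text \<open>A real supremum is an upper bound only for a bounded set, so both nested suprema are
  bounded first: E_0 \<le> \<rho> C gives \<rho> (C - R) for the inner one and \<bar>C - R\<bar> for
  the outer one.\<close>

lemma gallager_exponent_le_random_coding_exponent:
  assumes "\<rho> \<in> {0..1}"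
  shows "gallager_E0 P \<rho> Q - \<rho> * R \<le> random_coding_exponent P R"
proof -
  have "gallager_E0 P \<rho> Q - \<rho> * R \<le> (SUP Q. gallager_E0 P \<rho> Q - \<rho> * R)"
    using assms by (intro cSUP_upper gallager_exponent_bdd) auto
  also have "\<dots> \<le> random_coding_exponent P R"
    unfolding random_coding_exponent_def
  proof (rule cSUP_upper[OF assms], rule bdd_aboveI2)
    fix r :: real assume r: "r \<in> {0..1}"
    then have "(SUP Q. gallager_E0 P r Q - r * R) \<le> r * (capacity P - R)"
      by (intro cSUP_least) (auto simp: right_diff_distrib gallager_E0_le_capacity)
    also have "\<dots> \<le> \<bar>capacity P - R\<bar>"
      using r mult_right_mono[of r 1 "\<bar>capacity P - R\<bar>"] abs_ge_self[of "capacity P - R"]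
        mult_left_mono[of "capacity P - R" "\<bar>capacity P - R\<bar>" r] by auto
    finally show "(SUP Q. gallager_E0 P r Q - r * R) \<le> \<bar>capacity P - R\<bar>" .
  qed
  finally show ?thesis .
qed

lemma random_coding_exponent_least:
  assumes "\<And>\<rho> Q. \<rho> \<in> {0..1} \<Longrightarrow> gallager_E0 P \<rho> Q - \<rho> * R \<le> B"
  shows "random_coding_exponent P R \<le> B"
  unfolding random_coding_exponent_def using assms by (intro cSUP_least) auto

text \<open>Near-optimal \<rho> and Q stand in for a maximizer; this is enough because exponents are
  only approached up to \<delta>.\<close>

lemma less_random_coding_exponentE:
  assumes "v < random_coding_exponent P R"
  obtains \<rho> Q where "\<rho> \<in> {0..1}" "v < gallager_E0 P \<rho> Q - \<rho> * R"
  using random_coding_exponent_least[of P R v] assms by (meson not_less)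

lemma random_coding_exponent_nonneg: "0 \<le> random_coding_exponent P R"
  using gallager_exponent_le_random_coding_exponent[of 0 P] by (simp add: gallager_E0_0)

lemma random_coding_exponent_antimono:
  assumes "a \<le> b"
  shows "random_coding_exponent P b \<le> random_coding_exponent P a"
proof (rule random_coding_exponent_least)
  fix \<rho> :: real and Q assume \<rho>: "\<rho> \<in> {0..1}"
  then have "gallager_E0 P \<rho> Q - \<rho> * b \<le> gallager_E0 P \<rho> Q - \<rho> * a"
    using assms by (simp add: mult_left_mono)
  also have "\<dots> \<le> random_coding_exponent P a"
    by (rule gallager_exponent_le_random_coding_exponent[OF \<rho>])
  finally show "gallager_E0 P \<rho> Q - \<rho> * b \<le> random_coding_exponent P a" .
qed

text \<open>Every function in the supremum is affine in the rate with slope -\<rho> in [-1, 0].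
  Together with antitonicity this gives continuity, hence the intermediate value argument for
  \<open>alpha_star\<close>.\<close>

lemma random_coding_exponent_lipschitz:
  assumes "a \<le> b"
  shows "random_coding_exponent P a \<le> random_coding_exponent P b + (b - a)"
proof (rule random_coding_exponent_least)
  fix \<rho> :: real and Q assume \<rho>: "\<rho> \<in> {0..1}"
  have "\<rho> * (b - a) \<le> b - a" using \<rho> assms by (simp add: mult_left_le_one_le)
  then show "gallager_E0 P \<rho> Q - \<rho> * a \<le> random_coding_exponent P b + (b - a)"
    using gallager_exponent_le_random_coding_exponent[OF \<rho>, of P Q b]
    by (simp add: right_diff_distrib)
qed

lemma random_coding_exponent_le_capacity_diff:
  assumes "R \<le> capacity P"
  shows "random_coding_exponent P R \<le> capacity P - R"
proof (rule random_coding_exponent_least)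
  fix \<rho> :: real and Q assume \<rho>: "\<rho> \<in> {0..1}"
  then have "\<rho> * (capacity P - R) \<le> capacity P - R" using assms by (simp add: mult_left_le_one_le)
  then show "gallager_E0 P \<rho> Q - \<rho> * R \<le> capacity P - R"
    using gallager_E0_le_capacity[of \<rho> P Q] \<rho> by (simp add: right_diff_distrib)
qed

lemma isCont_random_coding_exponent: "isCont (random_coding_exponent P) a"
proof -
  have "\<bar>random_coding_exponent P b - random_coding_exponent P a\<bar> \<le> \<bar>b - a\<bar>" for b
    using random_coding_exponent_lipschitz[of a b P] random_coding_exponent_lipschitz[of b a P]
      random_coding_exponent_antimono[of a b P] random_coding_exponent_antimono[of b a P]
    by linarith
  then have bound: "\<forall>\<^sub>F b in at a. norm (random_coding_exponent P b - random_coding_exponent P a) \<le> \<bar>b - a\<bar>"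
    by (simp add: always_eventually)
  have "((\<lambda>b. \<bar>b - a\<bar>) \<longlongrightarrow> \<bar>a - a\<bar>) (at a)"
    by (intro tendsto_intros)
  then have "((\<lambda>b. random_coding_exponent P b - random_coding_exponent P a) \<longlongrightarrow> 0) (at a)"
    by (intro Lim_null_comparison[OF bound]) simp
  then show ?thesis unfolding isCont_def by (simp add: LIM_zero_iff)
qed

text \<open>The continuous ratio g(a) = E_r(a)/a is at least \<gamma>/R at a = R and at most
  \<gamma>/R close to capacity, so it takes this value at some rate a between. Then
  \<open>alpha_star\<close> is R/a, and the second claim is R g(a) = \<gamma>.\<close>

lemma alpha_star:
  assumes R: "0 < R" "R < capacity P" and \<gamma>: "0 < \<gamma>" "\<gamma> < random_coding_exponent P R"
  shows "0 < alpha_star P R \<gamma>"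
    and "alpha_star P R \<gamma> * random_coding_exponent P (R / alpha_star P R \<gamma>) = \<gamma>"
proof -
  define g where "g a = random_coding_exponent P a / a" for a
  \<comment> \<open>At this rate C - b \<le> \<gamma>/2, so E_r(b) < \<gamma>; b \<ge> R then gives
    g b \<le> \<gamma>/R.\<close>
  define b where "b = max R (capacity P - \<gamma> / 2)"
  have b: "R \<le> b" "b < capacity P" using R \<gamma> by (auto simp: b_def)
  have "random_coding_exponent P b < \<gamma>"
    using random_coding_exponent_le_capacity_diff[of b P] b \<gamma> by (auto simp: b_def)
  also have "\<gamma> \<le> \<gamma> * (b / R)" using R \<gamma> b by (simp add: field_simps)
  finally have gb: "g b \<le> \<gamma> / R" using R b unfolding g_def by (simp add: field_simps)
  moreover have "\<gamma> / R \<le> g R" using R \<gamma> by (simp add: g_def divide_right_mono)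
  moreover have "isCont g a" if "R \<le> a" for a
    unfolding g_def using R that by (intro continuous_intros isCont_random_coding_exponent) auto
  ultimately have "\<exists>a\<ge>R. a \<le> b \<and> g a = \<gamma> / R"
    by (intro IVT2) (use b in auto)
  then obtain a where a: "R \<le> a" "a \<le> b" "g a = \<gamma> / R" by blast
  \<comment> \<open>\<open>the_inv_into\<close> is a definite description, so the preimage has to be
    unique. Where the ratio equals \<gamma>/R > 0 the exponent is positive; as it is nonincreasing,
    a larger rate gives a strictly smaller ratio.\<close>
  have uniq: "c = a" if c: "0 < c" "g c = \<gamma> / R" for c
  proof -
    have False if "0 < u" "u < v" "g u = \<gamma> / R" "g v = \<gamma> / R" for u v
    proof -
      have "0 < random_coding_exponent P v"
      proof -
        have "random_coding_exponent P v = \<gamma> / R * v"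
          using that by (simp add: g_def field_simps)
        then show ?thesis using that R \<gamma> by simp
      qed
      then have "g v < random_coding_exponent P v / u"
        unfolding g_def using that by (intro divide_strict_left_mono) auto
      also have "\<dots> \<le> g u"
        unfolding g_def using that by (intro divide_right_mono random_coding_exponent_antimono) auto
      finally show False using that by simp
    qed
    from this[of a c] this[of c a] show ?thesis using a c R by (cases a c rule: linorder_cases) auto
  qed
  have "the_inv_into {0<..<capacity P} g (\<gamma> / R) = a"
    unfolding the_inv_into_def
    by (rule the_equality) (use a b R uniq in auto)
  then have eq: "alpha_star P R \<gamma> = R / a" by (simp add: alpha_star_def g_def[abs_def])
  show "0 < alpha_star P R \<gamma>" using eq a R by simp
  have "R / (R / a) = a" using R a by simp
  then show "alpha_star P R \<gamma> * random_coding_exponent P (R / alpha_star P R \<gamma>) = \<gamma>"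
    unfolding eq using a R by (simp add: g_def field_simps)
qed

section \<open>Random block codes\<close>

lemma length_outputs: "ys \<in> set_pmf (outputs P \<phi> n) \<Longrightarrow> length ys = n"
  by (induction n arbitrary: ys) auto

lemma finite_lists_length: "finite {ys :: 'y::finite list. length ys = n}"
  using finite_lists_length_eq[of "UNIV :: 'y set" n] by simp

lemma finite_set_outputs: "finite (set_pmf (outputs P \<phi> n :: 'y::finite list pmf))"
  by (rule finite_subset[OF _ finite_lists_length[of n]]) (auto simp: length_outputs)

lemma outputs_cong:
  assumes "\<And>ys. length ys < n \<Longrightarrow> \<phi> ys = \<psi> ys"
  shows "outputs P \<phi> n = outputs P \<psi> n"
  using assms
proof (induction n)
  case (Suc n)
  then have "outputs P \<phi> n = outputs P \<psi> n" by simp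
  then show ?case using Suc.prems length_outputs[of _ P \<psi> n]
    by (auto intro!: bind_pmf_cong)
qed simp

text \<open>After a prefix \<open>ys\<close> a feedback encoder continues as a feedback encoder that
  has \<open>ys\<close> prepended to its observations. This allows the phases to be analysed one at
  a time.\<close>

lemma outputs_add:
  "outputs P \<phi> (m + n) =
     outputs P \<phi> m \<bind> (\<lambda>ys. map_pmf ((@) ys) (outputs P (\<lambda>zs. \<phi> (ys @ zs)) n))"
proof (induction n)
  case 0
  show ?case by (simp add: bind_return_pmf')
next
  case (Suc n)
  show ?case
    by (simp add: Suc bind_assoc_pmf map_bind_pmf bind_map_pmf pmf.map_comp o_def)
qed

lemma pmf_outputs:
  assumes "length ys = n"
  shows "pmf (outputs P \<phi> n) ys = (\<Prod>i<n. pmf (P (\<phi> (take i ys))) (ys ! i))"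
  using assms
proof (induction n arbitrary: ys)
  case (Suc n)
  then obtain zs y where ys: "ys = zs @ [y]" "length zs = n"
    by (metis length_Suc_conv_rev)
  have "pmf (map_pmf (\<lambda>y. zs' @ [y]) (P (\<phi> zs'))) ys = (if zs' = zs then pmf (P (\<phi> zs)) y else 0)" for zs'
  proof (cases "zs' = zs")
    case True
    then show ?thesis using pmf_map_inj'[of "\<lambda>y. zs @ [y]" "P (\<phi> zs)" y] ys by (simp add: inj_on_def)
  next
    case False
    then show ?thesis by (subst pmf_map_outside) (auto simp: ys)
  qed
  then have "pmf (outputs P \<phi> (Suc n)) ys = pmf (outputs P \<phi> n) zs * pmf (P (\<phi> zs)) y"
    by (simp add: pmf_bind) (subst integral_measure_pmf_real[where A="{zs}"]; auto split: if_splits)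
  also have "\<dots> = (\<Prod>i<Suc n. pmf (P (\<phi> (take i ys))) (ys ! i))"
    using Suc.IH[of zs] ys by (simp add: nth_append cong: prod.cong_simp)
  finally show ?case .
qed simp

lemma prob_outputs_eq_sum:
  fixes P :: "'x \<Rightarrow> 'y::finite pmf"
  shows "measure_pmf.prob (outputs P \<phi> n) A = (\<Sum>ys | length ys = n \<and> ys \<in> A. pmf (outputs P \<phi> n) ys)"
proof -
  have "measure_pmf.prob (outputs P \<phi> n) A = measure_pmf.prob (outputs P \<phi> n) {ys. length ys = n \<and> ys \<in> A}"
    by (intro measure_prob_cong_0) (auto simp: pmf_eq_0_set_pmf dest: length_outputs)
  then show ?thesis
    by (simp add: measure_measure_pmf_finite finite_subset[OF _ finite_lists_length[of n]] subset_eq)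
qed

lemma prob_bind_pmf:
  "measure_pmf.prob (bind_pmf p f) A = measure_pmf.expectation p (\<lambda>x. measure_pmf.prob (f x) A)"
proof -
  have "ennreal (measure_pmf.prob (bind_pmf p f) A) = (\<integral>\<^sup>+x. ennreal (measure_pmf.prob (f x) A) \<partial>p)"
    by (simp flip: measure_pmf.emeasure_eq_measure)
  also have "\<dots> = ennreal (measure_pmf.expectation p (\<lambda>x. measure_pmf.prob (f x) A))"
    by (intro nn_integral_eq_integral measure_pmf.integrable_const_bound[where B=1]) auto
  finally show ?thesis by (simp add: ennreal_inj)
qed

text \<open>Conditioning on the first m outputs. The bound b is asked only of prefixes in A because
  the encoder's later behaviour depends on them: with A the wrong tentative decisions, this is what
  multiplies the first-phase error by the type II error.\<close>

lemma prob_outputs_split_le: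
  fixes P :: "'x \<Rightarrow> 'y::finite pmf"
  assumes "\<And>ys. length ys = m \<Longrightarrow> ys \<in> A \<Longrightarrow> measure_pmf.prob (outputs P (\<lambda>zs. \<phi> (ys @ zs)) n) B \<le> b"
  shows "measure_pmf.prob (outputs P \<phi> (m + n)) {ys. take m ys \<in> A \<and> drop m ys \<in> B}
     \<le> measure_pmf.prob (outputs P \<phi> m) A * b"
proof -
  have "measure_pmf.prob (outputs P \<phi> (m + n)) {ys. take m ys \<in> A \<and> drop m ys \<in> B}
      \<le> measure_pmf.expectation (outputs P \<phi> m) (\<lambda>ys. indicator A ys * b)"
    unfolding outputs_add prob_bind_pmf
  proof (intro integral_mono_AE AE_pmfI)
    fix ys assume "ys \<in> set_pmf (outputs P \<phi> m)"
    then have l: "length ys = m" by (rule length_outputs)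
    then have "((@) ys) -` {ys. take m ys \<in> A \<and> drop m ys \<in> B} = (if ys \<in> A then B else {})"
      by auto
    then show "measure_pmf.prob (map_pmf ((@) ys) (outputs P (\<lambda>zs. \<phi> (ys @ zs)) n))
        {ys. take m ys \<in> A \<and> drop m ys \<in> B} \<le> indicator A ys * b"
      using assms[OF l] by (auto simp: indicator_def)
  qed (auto intro: integrable_measure_pmf_finite finite_set_outputs)
  then show ?thesis by simp
qed

lemma prob_outputs_prefix_le:
  fixes P :: "'x \<Rightarrow> 'y::finite pmf"
  shows "measure_pmf.prob (outputs P \<phi> (m + n)) {ys. take m ys \<in> A} \<le> measure_pmf.prob (outputs P \<phi> m) A"
  using prob_outputs_split_le[of m A P \<phi> n UNIV 1] by simp

lemma prob_outputs_suffix_le: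
  fixes P :: "'x \<Rightarrow> 'y::finite pmf"
  assumes "\<And>ys. length ys = m \<Longrightarrow> measure_pmf.prob (outputs P (\<lambda>zs. \<phi> (ys @ zs)) n) B \<le> b"
  shows "measure_pmf.prob (outputs P \<phi> (m + n)) {ys. drop m ys \<in> B} \<le> b"
  using prob_outputs_split_le[of m UNIV P \<phi> n B b] assms by simp

lemma sum_prod_lists:
  fixes b :: "'y::finite \<Rightarrow> 'a::comm_semiring_1"
  shows "(\<Sum>ys | length ys = n. \<Prod>i<n. b (ys ! i)) = (\<Sum>y\<in>UNIV. b y) ^ n"
proof (induction n)
  case (Suc n)
  have "(\<Sum>ys | length ys = Suc n. \<Prod>i<Suc n. b (ys ! i)) =
      (\<Sum>(ys, y)\<in>{ys. length ys = n} \<times> UNIV. (\<Prod>i<n. b (ys ! i)) * b y)"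
  proof (rule sum.reindex_bij_witness[of _ "\<lambda>(ys, y). ys @ [y]" "\<lambda>ys. (butlast ys, last ys)"])
    fix ys :: "'y list" assume "ys \<in> {ys. length ys = Suc n}"
    then obtain zs y where "ys = zs @ [y]" "length zs = n" by (auto simp: length_Suc_conv_rev)
    then show "(case (butlast ys, last ys) of (ys, y) \<Rightarrow> (\<Prod>i<n. b (ys ! i)) * b y) = (\<Prod>i<Suc n. b (ys ! i))"
      by (simp add: nth_append cong: prod.cong_simp)
  qed (auto intro!: append_butlast_last_id)
  also have "\<dots> = (\<Sum>y\<in>UNIV. b y) ^ Suc n"
    by (simp add: Suc mult.commute flip: sum.cartesian_product sum_distrib_left sum_distrib_right)
  finally show ?case .
qed simp

lemma prod_powr: "(\<Prod>i\<in>I. f i) powr t = (\<Prod>i\<in>I. f i powr t)" if "finite I" "\<And>i. i \<in> I \<Longrightarrow> 0 \<le> (f i :: real)"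
  using that by (induction I rule: finite_induct) (auto simp: powr_mult prod_nonneg)

section \<open>Maximum likelihood decoding of block codes\<close>

definition word_likelihood :: "('x \<Rightarrow> 'y pmf) \<Rightarrow> nat \<Rightarrow> (nat \<Rightarrow> 'x) \<Rightarrow> 'y list \<Rightarrow> real" where
  "word_likelihood P n u ys = (\<Prod>i<n. pmf (P (u i)) (ys ! i))"

lemma word_likelihood_nonneg: "0 \<le> word_likelihood P n u ys"
  by (simp add: word_likelihood_def prod_nonneg)

lemma prob_word_outputs:
  fixes P :: "'x \<Rightarrow> 'y::finite pmf"
  shows "measure_pmf.prob (outputs P (\<lambda>ys. u (length ys)) n) A =
    (\<Sum>ys | length ys = n \<and> ys \<in> A. word_likelihood P n u ys)"
  unfolding prob_outputs_eq_sum word_likelihood_def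
  by (intro sum.cong) (auto simp: pmf_outputs intro!: prod.cong)

definition ml_decoder :: "('x \<Rightarrow> 'y pmf) \<Rightarrow> nat \<Rightarrow> nat \<Rightarrow> (nat \<Rightarrow> nat \<Rightarrow> 'x) \<Rightarrow> 'y list \<Rightarrow> nat" where
  "ml_decoder P n M cb ys = (ARG_MAX (\<lambda>m. word_likelihood P n (cb m) ys) m. m \<in> {1..M})"

lemma ml_decoder:
  assumes "1 \<le> M"
  shows "ml_decoder P n M cb ys \<in> {1..M}"
    and "m \<in> {1..M} \<Longrightarrow> word_likelihood P n (cb m) ys \<le> word_likelihood P n (cb (ml_decoder P n M cb ys)) ys"
proof -
  let ?f = "\<lambda>m. word_likelihood P n (cb m) ys"
  have "\<exists>k\<in>{1..M}. ?f k = Max (?f ` {1..M})"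
    using Max_in[of "?f ` {1..M}"] assms by fastforce
  then obtain k where "k \<in> {1..M}" "\<forall>m\<in>{1..M}. ?f m \<le> ?f k" by auto
  then have "is_arg_max ?f (\<lambda>m. m \<in> {1..M}) k" by (auto simp: is_arg_max_linorder)
  then have "is_arg_max ?f (\<lambda>m. m \<in> {1..M}) (ml_decoder P n M cb ys)"
    unfolding ml_decoder_def arg_max_def by (rule someI)
  then show "ml_decoder P n M cb ys \<in> {1..M}"
    and "m \<in> {1..M} \<Longrightarrow> ?f m \<le> ?f (ml_decoder P n M cb ys)"
    by (auto simp: is_arg_max_linorder)
qed

text \<open>Gallager's trick: on an error some competitor is at least as likely as the true word, so
  the sum of the competitors' powers t divided by that of the true word is at least 1, and so is its
  power \<rho>. The choice of t makes t + t \<rho> = 1, which leaves the power t of the true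
  likelihood.\<close>

lemma ml_error_le:
  assumes "1 \<le> M" "0 \<le> \<rho>" "ml_decoder P n M cb ys \<noteq> m" "m \<in> {1..M}"
  defines "t \<equiv> 1 / (1 + \<rho>)"
  shows "word_likelihood P n (cb m) ys \<le> word_likelihood P n (cb m) ys powr t *
     (\<Sum>k\<in>{1..M} - {m}. word_likelihood P n (cb k) ys powr t) powr \<rho>"
proof (cases "word_likelihood P n (cb m) ys = 0")
  case False
  let ?w = "\<lambda>k. word_likelihood P n (cb k) ys"
  let ?d = "ml_decoder P n M cb ys"
  have t: "0 < t" "t + t * \<rho> = 1" using assms by (auto simp: t_def divide_simps)
  have "0 < ?w m" using False word_likelihood_nonneg[of P n "cb m" ys] by simp
  have "?w m powr t \<le> ?w ?d powr t"
    using ml_decoder(2)[of M m P n cb ys] assms t by (intro powr_mono2) (auto simp: word_likelihood_nonneg)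
  also have "\<dots> \<le> (\<Sum>k\<in>{1..M} - {m}. ?w k powr t)"
    using ml_decoder(1)[OF assms(1), of P n cb ys] assms by (intro member_le_sum) auto
  finally have "(?w m powr t) powr \<rho> \<le> (\<Sum>k\<in>{1..M} - {m}. ?w k powr t) powr \<rho>"
    using assms by (intro powr_mono2) auto
  then have "?w m powr t * (?w m powr t) powr \<rho> \<le> ?w m powr t * (\<Sum>k\<in>{1..M} - {m}. ?w k powr t) powr \<rho>"
    by (intro mult_left_mono) auto
  moreover have "?w m powr t * (?w m powr t) powr \<rho> = ?w m"
    using \<open>0 < ?w m\<close> t by (simp add: powr_powr flip: powr_add)
  ultimately show ?thesis by simp
qed simp

section \<open>Averaging over a random codebook\<close>

lemma expectation_powr_le:
  fixes f :: "'a \<Rightarrow> real"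
  assumes "finite (set_pmf p)" "\<And>x. x \<in> set_pmf p \<Longrightarrow> 0 \<le> f x" "0 \<le> \<rho>" "\<rho> \<le> 1"
  shows "measure_pmf.expectation p (\<lambda>x. f x powr \<rho>) \<le> measure_pmf.expectation p f powr \<rho>"
  using sum_powr_le_powr_sum[OF assms(1), of "pmf p" f \<rho>] assms
  by (simp add: integral_measure_pmf_real[where A="set_pmf p"] sum_pmf_eq_1 mult.commute)

lemma exists_le_expectation:
  assumes "finite (set_pmf p)" "measure_pmf.expectation p f \<le> (b :: real)"
  shows "\<exists>x. f x \<le> b"
proof (rule ccontr)
  assume "\<not> ?thesis"
  then have "\<And>x. - f x < - b" by (simp add: not_le)
  then have "measure_pmf.expectation p (\<lambda>x. - f x) < - b"
    using assms by (intro measure_pmf.expectation_less) (auto intro: integrable_measure_pmf_finite)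
  then show False using assms by simp
qed

lemma finite_set_Pi_pmf:
  assumes "finite A" "\<And>x. x \<in> A \<Longrightarrow> finite (set_pmf (p x))"
  shows "finite (set_pmf (Pi_pmf A dflt p))"
  using assms by (auto simp: set_Pi_pmf)

lemma random_codeword_expectation:
  fixes P :: "'x::finite \<Rightarrow> 'y::finite pmf"
  shows "measure_pmf.expectation (Pi_pmf {..<n} undefined (\<lambda>_. Q)) (\<lambda>u. word_likelihood P n u ys powr t) =
     (\<Prod>i<n. \<Sum>x\<in>UNIV. pmf Q x * pmf (P x) (ys ! i) powr t)"
proof -
  have "measure_pmf.expectation (Pi_pmf {..<n} undefined (\<lambda>_. Q)) (\<lambda>u. word_likelihood P n u ys powr t) =
      measure_pmf.expectation (Pi_pmf {..<n} undefined (\<lambda>_. Q)) (\<lambda>u. \<Prod>i<n. pmf (P (u i)) (ys ! i) powr t)"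
    by (simp add: word_likelihood_def prod_powr)
  also have "\<dots> = (\<Prod>i<n. measure_pmf.expectation Q (\<lambda>x. pmf (P x) (ys ! i) powr t))"
    by (intro expectation_prod_Pi_pmf) (auto intro: integrable_measure_pmf_finite)
  finally show ?thesis
    by (simp add: integral_measure_pmf_real[where A=UNIV] mult.commute)
qed

text \<open>Independence of the codewords separates the true one from its competitors. Jensen then
  moves the expectation inside the power \<rho>, which is where concavity, hence \<rho> \<le> 1, is
  needed.\<close>

lemma random_coding_word:
  fixes C :: "'u pmf" and w :: "'u \<Rightarrow> real"
  assumes C: "finite (set_pmf C)" and "finite A" "m \<notin> A" and w: "\<And>u. 0 \<le> w u" and \<rho>: "0 \<le> \<rho>" "\<rho> \<le> 1"
  defines "a \<equiv> measure_pmf.expectation C w"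
  shows "measure_pmf.expectation (Pi_pmf (insert m A) dflt (\<lambda>_. C))
      (\<lambda>cb. w (cb m) * (\<Sum>k\<in>A. w (cb k)) powr \<rho>) \<le> a * (real (card A) * a) powr \<rho>"
proof -
  let ?B = "Pi_pmf A dflt (\<lambda>_. C)"
  have fin: "finite (set_pmf ?B)" using assms by (intro finite_set_Pi_pmf) auto
  have upd: "(\<Sum>k\<in>A. w ((f(m := u)) k)) = (\<Sum>k\<in>A. w (f k))" for f u
    using \<open>m \<notin> A\<close> by (intro sum.cong) auto
  have "measure_pmf.expectation (Pi_pmf (insert m A) dflt (\<lambda>_. C)) (\<lambda>cb. w (cb m) * (\<Sum>k\<in>A. w (cb k)) powr \<rho>)
      = measure_pmf.expectation (pair_pmf C ?B) (\<lambda>x. w (fst x) * (\<Sum>k\<in>A. w (snd x k)) powr \<rho>)"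
    using assms by (subst Pi_pmf_insert) (auto simp: case_prod_beta upd simp del: fun_upd_apply cong: sum.cong, simp)
  also have "\<dots> = (\<Sum>x\<in>set_pmf C \<times> set_pmf ?B.
      (w (fst x) * pmf C (fst x)) * ((\<Sum>k\<in>A. w (snd x k)) powr \<rho> * pmf ?B (snd x)))"
    using C fin by (subst integral_measure_pmf_real[where A="set_pmf C \<times> set_pmf ?B"])
      (auto simp: pmf_pair intro!: sum.cong)
  also have "\<dots> = (\<Sum>u\<in>set_pmf C. w u * pmf C u) * (\<Sum>f\<in>set_pmf ?B. (\<Sum>k\<in>A. w (f k)) powr \<rho> * pmf ?B f)"
    unfolding sum_product sum.cartesian_product by (simp add: case_prod_beta)
  also have "\<dots> = a * measure_pmf.expectation ?B (\<lambda>f. (\<Sum>k\<in>A. w (f k)) powr \<rho>)"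
    using C fin unfolding a_def by (simp add: integral_measure_pmf_real)
  also have "\<dots> \<le> a * measure_pmf.expectation ?B (\<lambda>f. \<Sum>k\<in>A. w (f k)) powr \<rho>"
    using w fin \<rho> unfolding a_def
    by (intro mult_left_mono expectation_powr_le integral_nonneg_AE) (auto intro: sum_nonneg)
  also have "measure_pmf.expectation ?B (\<lambda>f. \<Sum>k\<in>A. w (f k)) = (\<Sum>k\<in>A. measure_pmf.expectation ?B (\<lambda>f. w (f k)))"
    using fin by (intro Bochner_Integration.integral_sum) (auto intro: integrable_measure_pmf_finite)
  also have "\<dots> = (\<Sum>k\<in>A. a)"
  proof (intro sum.cong refl)
    fix k assume k: "k \<in> A"
    have "measure_pmf.expectation ?B (\<lambda>f. w (f k)) = measure_pmf.expectation (map_pmf (\<lambda>f. f k) ?B) w"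
      by simp
    also have "map_pmf (\<lambda>f. f k) ?B = C" using k assms by (simp add: Pi_pmf_component)
    finally show "measure_pmf.expectation ?B (\<lambda>f. w (f k)) = a" by (simp add: a_def)
  qed
  finally show ?thesis by simp
qed

text \<open>The mean error over a codebook with independent letters of law Q obeys the bound for
  each message, so some codebook obeys it on average over the messages. A deterministic codebook
  thus suffices and no common randomness has to be drawn.\<close>

lemma random_coding_bound:
  fixes P :: "'x::finite \<Rightarrow> 'y::finite pmf"
  assumes M: "1 \<le> M" and \<rho>: "0 \<le> \<rho>" "\<rho> \<le> 1"
  shows "\<exists>cb d. (\<forall>ys. d ys \<in> {1..M}) \<and>
    (\<Sum>m\<in>{1..M}. measure_pmf.prob (outputs P (\<lambda>ys. cb m (length ys)) n) {ys. d ys \<noteq> m}) / real M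
      \<le> real (M - 1) powr \<rho> * 2 powr (- real n * gallager_E0 P \<rho> Q)"
proof -
  define t where "t = 1 / (1 + \<rho>)"
  define C :: "(nat \<Rightarrow> 'x) pmf" where "C = Pi_pmf {..<n} undefined (\<lambda>_. Q)"
  define B where "B = Pi_pmf {1..M} undefined (\<lambda>_. C)"
  define w where "w ys u = word_likelihood P n u ys powr t" for ys u
  define b where "b y = (\<Sum>x\<in>UNIV. pmf Q x * pmf (P x) y powr t)" for y
  define a where "a ys = (\<Prod>i<n. b (ys ! i))" for ys
  define err where "err cb m = measure_pmf.prob (outputs P (\<lambda>ys. cb m (length ys)) n)
    {ys. ml_decoder P n M cb ys \<noteq> m}" for cb :: "nat \<Rightarrow> nat \<Rightarrow> 'x" and m
  have finC: "finite (set_pmf C)" unfolding C_def by (intro finite_set_Pi_pmf) auto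
  have finB: "finite (set_pmf B)" using finC unfolding B_def by (intro finite_set_Pi_pmf) auto
  have Ew: "measure_pmf.expectation C (w ys) = a ys" for ys
    unfolding C_def w_def a_def b_def by (rule random_codeword_expectation)
  have w0: "0 \<le> w ys u" for ys u by (simp add: w_def)
  have b0: "0 \<le> b y" for y by (simp add: b_def sum_nonneg)
  then have a0: "0 \<le> a ys" for ys by (simp add: a_def prod_nonneg)
  have sum_a: "(\<Sum>ys | length ys = n. a ys powr (1 + \<rho>)) = 2 powr (- real n * gallager_E0 P \<rho> Q)"
  proof -
    have "(\<Sum>ys | length ys = n. a ys powr (1 + \<rho>)) = (\<Sum>ys | length ys = n. \<Prod>i<n. b (ys ! i) powr (1 + \<rho>))"
      using b0 by (simp add: a_def prod_powr)
    also have "\<dots> = (2 powr (- gallager_E0 P \<rho> Q)) ^ n"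
      unfolding two_powr_gallager_E0 sum_prod_lists[of "\<lambda>y. b y powr (1 + \<rho>)"] by (simp add: b_def t_def)
    finally show ?thesis by (simp add: powr_powr mult.commute flip: powr_realpow)
  qed
  have "measure_pmf.expectation B (\<lambda>cb. err cb m) \<le> real (M - 1) powr \<rho> * 2 powr (- real n * gallager_E0 P \<rho> Q)"
    if m: "m \<in> {1..M}" for m
  proof -
    \<comment> \<open>\<open>ml_error_le\<close> bounds the error words; the sum is then extended to
      all words, whose terms are nonnegative. The resulting sum factorizes over letters.\<close>
    have "err cb m \<le> (\<Sum>ys | length ys = n. w ys (cb m) * (\<Sum>k\<in>{1..M} - {m}. w ys (cb k)) powr \<rho>)" for cb
      unfolding err_def prob_word_outputs w_def t_def
      by (rule sum_le_included[where i="\<lambda>x. x"])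
        (use ml_error_le[OF M \<rho>(1) _ m] in \<open>auto simp: finite_lists_length finite_subset[OF _ finite_lists_length[of n]] subset_eq\<close>)
    then have "measure_pmf.expectation B (\<lambda>cb. err cb m) \<le>
        measure_pmf.expectation B (\<lambda>cb. \<Sum>ys | length ys = n. w ys (cb m) * (\<Sum>k\<in>{1..M} - {m}. w ys (cb k)) powr \<rho>)"
      using finB by (intro integral_mono) (auto intro: integrable_measure_pmf_finite)
    also have "\<dots> = (\<Sum>ys | length ys = n. measure_pmf.expectation B
        (\<lambda>cb. w ys (cb m) * (\<Sum>k\<in>{1..M} - {m}. w ys (cb k)) powr \<rho>))"
      using finB by (intro Bochner_Integration.integral_sum) (auto intro: integrable_measure_pmf_finite)
    also have "\<dots> \<le> (\<Sum>ys | length ys = n. a ys * (real (M - 1) * a ys) powr \<rho>)"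
    proof (intro sum_mono)
      fix ys
      have "insert m ({1..M} - {m}) = {1..M}" "card ({1..M} - {m}) = M - 1" using m by auto
      then show "measure_pmf.expectation B (\<lambda>cb. w ys (cb m) * (\<Sum>k\<in>{1..M} - {m}. w ys (cb k)) powr \<rho>)
          \<le> a ys * (real (M - 1) * a ys) powr \<rho>"
        using random_coding_word[OF finC _ _ _ \<rho>, of "{1..M} - {m}" m "w ys" undefined] w0
        by (simp add: B_def Ew)
    qed
    also have "\<dots> = (\<Sum>ys | length ys = n. real (M - 1) powr \<rho> * a ys powr (1 + \<rho>))"
      using a0 by (intro sum.cong) (auto simp: powr_mult powr_add)
    also have "\<dots> = real (M - 1) powr \<rho> * 2 powr (- real n * gallager_E0 P \<rho> Q)"
      by (simp add: sum_a flip: sum_distrib_left)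
    finally show ?thesis .
  qed
  then have "(\<Sum>m\<in>{1..M}. measure_pmf.expectation B (\<lambda>cb. err cb m))
      \<le> real M * (real (M - 1) powr \<rho> * 2 powr (- real n * gallager_E0 P \<rho> Q))"
    using sum_bounded_above[of "{1..M}" "\<lambda>m. measure_pmf.expectation B (\<lambda>cb. err cb m)"] by simp
  moreover have "measure_pmf.expectation B (\<lambda>cb. (\<Sum>m\<in>{1..M}. err cb m) / real M)
      = (\<Sum>m\<in>{1..M}. measure_pmf.expectation B (\<lambda>cb. err cb m)) / real M"
    using finB by (simp add: Bochner_Integration.integral_sum integrable_measure_pmf_finite)
  ultimately have "measure_pmf.expectation B (\<lambda>cb. (\<Sum>m\<in>{1..M}. err cb m) / real M)
      \<le> real (M - 1) powr \<rho> * 2 powr (- real n * gallager_E0 P \<rho> Q)"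
    using M by (simp add: field_simps)
  from exists_le_expectation[OF finB this] obtain cb
    where "(\<Sum>m\<in>{1..M}. err cb m) / real M \<le> real (M - 1) powr \<rho> * 2 powr (- real n * gallager_E0 P \<rho> Q)"
    by blast
  then show ?thesis
    using ml_decoder(1)[OF M] unfolding err_def
    by (intro exI[of _ cb] exI[of _ "ml_decoder P n M cb"]) auto
qed

section \<open>Confirmation of the tentative decision\<close>

text \<open>For 0 < s < 1 this is the normalizer of the tilted law, \<open>powr\<close> agreeing
  with \<open>prob_powr\<close> there.\<close>

definition chernoff_sum :: "('x \<Rightarrow> 'y::finite pmf) \<Rightarrow> 'x \<Rightarrow> 'x \<Rightarrow> real \<Rightarrow> real" where
  "chernoff_sum P x x' s = (\<Sum>y\<in>UNIV. pmf (P x) y powr (1 - s) * pmf (P x') y powr s)"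

text \<open>The test being true is a verdict for \<open>x'\<close>, that is, a rejection of the
  tentative decision. The product form avoids division by a vanishing likelihood; t is a threshold
  in bits per output.\<close>

definition likelihood_ratio_test :: "('x \<Rightarrow> 'y pmf) \<Rightarrow> 'x \<Rightarrow> 'x \<Rightarrow> real \<Rightarrow> 'y list \<Rightarrow> bool" where
  "likelihood_ratio_test P x x' t ys \<longleftrightarrow>
     2 powr (t * real (length ys)) * word_likelihood P (length ys) (\<lambda>_. x) ys
       \<le> word_likelihood P (length ys) (\<lambda>_. x') ys"

lemma sum_tilted_word_likelihood:
  fixes P :: "'x \<Rightarrow> 'y::finite pmf"
  shows "(\<Sum>ys | length ys = n. word_likelihood P n (\<lambda>_. x) ys powr (1 - s) * word_likelihood P n (\<lambda>_. x') ys powr s)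
     = chernoff_sum P x x' s ^ n"
  using sum_prod_lists[of "\<lambda>y. pmf (P x) y powr (1 - s) * pmf (P x') y powr s" n]
  by (simp add: chernoff_sum_def word_likelihood_def prod_powr prod.distrib)

lemma powr_split:
  fixes a :: real assumes "0 \<le> a" shows "a = a powr (1 - s) * a powr s"
  using assms by (simp flip: powr_add)

text \<open>Chernoff's argument: where T p \<le> q, the factor \<open>p powr s\<close> of p is at
  most T^(-s) times \<open>q powr s\<close>. Summing the result over all words gives a power of the
  single-letter sum.\<close>

lemma likelihood_ratio_test_type_I:
  fixes P :: "'x \<Rightarrow> 'y::finite pmf"
  assumes s: "0 < s" "s < 1"
  shows "measure_pmf.prob (outputs P (\<lambda>_. x) n) {ys. likelihood_ratio_test P x x' t ys}
     \<le> (2 powr (- t * s) * chernoff_sum P x x' s) ^ n"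
proof -
  let ?p = "word_likelihood P n (\<lambda>_. x)" and ?q = "word_likelihood P n (\<lambda>_. x')"
  define T where "T = 2 powr (t * real n)"
  have T: "0 < T" by (simp add: T_def)
  have le: "?p ys \<le> T powr (- s) * (?p ys powr (1 - s) * ?q ys powr s)" if "T * ?p ys \<le> ?q ys" for ys
  proof -
    have "?p ys \<le> T powr (- s) * ?q ys powr s * ?p ys powr (1 - s)"
    proof -
      have "(T * ?p ys) powr s \<le> ?q ys powr s"
        using that s T by (intro powr_mono2) (auto simp: word_likelihood_nonneg)
      then have "T powr s * ?p ys powr s \<le> ?q ys powr s"
        using T by (simp add: powr_mult word_likelihood_nonneg)
      then have "?p ys powr s \<le> T powr (- s) * ?q ys powr s"
        using T by (simp add: powr_minus field_simps)
      then have "?p ys powr (1 - s) * ?p ys powr s \<le> ?p ys powr (1 - s) * (T powr (- s) * ?q ys powr s)"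
        by (intro mult_left_mono) auto
      then show ?thesis
        using powr_split[OF word_likelihood_nonneg, of P n "\<lambda>_. x" ys s] by (simp add: mult_ac)
    qed
    then show ?thesis by (simp add: mult_ac)
  qed
  have "measure_pmf.prob (outputs P (\<lambda>_. x) n) {ys. likelihood_ratio_test P x x' t ys}
      = (\<Sum>ys | length ys = n \<and> T * ?p ys \<le> ?q ys. ?p ys)"
    unfolding prob_word_outputs[of P "\<lambda>_. x"]
    by (intro sum.cong) (auto simp: likelihood_ratio_test_def T_def)
  also have "\<dots> \<le> (\<Sum>ys | length ys = n. T powr (- s) * (?p ys powr (1 - s) * ?q ys powr s))"
    by (rule sum_le_included[where i="\<lambda>x. x"])
      (use le in \<open>auto simp: finite_lists_length finite_subset[OF _ finite_lists_length[of n]] subset_eq\<close>)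
  also have "\<dots> = T powr (- s) * chernoff_sum P x x' s ^ n"
    by (simp add: sum_tilted_word_likelihood flip: sum_distrib_left)
  also have "T powr (- s) = (2 powr (- t * s)) ^ n"
    by (simp add: T_def powr_powr mult_ac flip: powr_realpow)
  finally show ?thesis by (simp add: power_mult_distrib)
qed

text \<open>The mirror image: where q < T p, the factor \<open>q powr (1 - s)\<close> of q is
  replaced by that of T p.\<close>

lemma likelihood_ratio_test_type_II:
  fixes P :: "'x \<Rightarrow> 'y::finite pmf"
  assumes s: "0 < s" "s < 1"
  shows "measure_pmf.prob (outputs P (\<lambda>_. x') n) {ys. \<not> likelihood_ratio_test P x x' t ys}
     \<le> (2 powr (t * (1 - s)) * chernoff_sum P x x' s) ^ n"
proof -
  let ?p = "word_likelihood P n (\<lambda>_. x)" and ?q = "word_likelihood P n (\<lambda>_. x')"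
  define T where "T = 2 powr (t * real n)"
  have T: "0 < T" by (simp add: T_def)
  have le: "?q ys \<le> T powr (1 - s) * (?p ys powr (1 - s) * ?q ys powr s)" if "\<not> T * ?p ys \<le> ?q ys" for ys
  proof -
    have "?q ys powr (1 - s) \<le> (T * ?p ys) powr (1 - s)"
      using that s by (intro powr_mono2) (auto simp: word_likelihood_nonneg)
    then have "?q ys powr (1 - s) * ?q ys powr s \<le> (T * ?p ys) powr (1 - s) * ?q ys powr s"
      by (intro mult_right_mono) auto
    then show ?thesis
      using powr_split[OF word_likelihood_nonneg, of P n "\<lambda>_. x'" ys s] T
      by (simp add: mult_ac powr_mult word_likelihood_nonneg)
  qed
  have "measure_pmf.prob (outputs P (\<lambda>_. x') n) {ys. \<not> likelihood_ratio_test P x x' t ys}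
      = (\<Sum>ys | length ys = n \<and> \<not> T * ?p ys \<le> ?q ys. ?q ys)"
    unfolding prob_word_outputs[of P "\<lambda>_. x'"]
    by (intro sum.cong) (auto simp: likelihood_ratio_test_def T_def)
  also have "\<dots> \<le> (\<Sum>ys | length ys = n. T powr (1 - s) * (?p ys powr (1 - s) * ?q ys powr s))"
    by (rule sum_le_included[where i="\<lambda>x. x"])
      (use le in \<open>auto simp: finite_lists_length finite_subset[OF _ finite_lists_length[of n]] subset_eq\<close>)
  also have "\<dots> = T powr (1 - s) * chernoff_sum P x x' s ^ n"
    by (simp add: sum_tilted_word_likelihood flip: sum_distrib_left)
  also have "T powr (1 - s) = (2 powr (t * (1 - s))) ^ n"
    by (simp add: T_def powr_powr mult_ac flip: powr_realpow)
  finally show ?thesis by (simp add: power_mult_distrib)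
qed

text \<open>The witness t is the mean of log (q/p) under the tilted law f. Inserting log f = (1 - s)
  log p + s log q - log Z makes both divergences affine in t, and they coincide with the exponents
  per letter of the two preceding error bounds at threshold t. They are finite because f lives on
  the common support.\<close>

lemma kl_div_tilted:
  fixes P :: "'x \<Rightarrow> 'y::finite pmf"
  assumes s: "0 < s" "s < 1" and Z: "chernoff_sum P x x' s \<noteq> 0"
  shows "\<exists>t. kl_div (tilted P x x' s) (measure_pmf (P x)) = ereal (s * t - log 2 (chernoff_sum P x x' s)) \<and>
    kl_div (tilted P x x' s) (measure_pmf (P x')) = ereal (- (1 - s) * t - log 2 (chernoff_sum P x x' s))"
proof -
  define Z where "Z = chernoff_sum P x x' s"
  define f where "f = tilted_density P x x' s"
  define p where "p = pmf (P x)"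
  define q where "q = pmf (P x')"
  have pq: "0 \<le> p y" "0 \<le> q y" for y by (simp_all add: p_def q_def)
  have Z0: "0 < Z"
    using Z by (auto simp: Z_def less_le chernoff_sum_def intro!: sum_nonneg)
  have f: "f y = p y powr (1 - s) * q y powr s / Z" for y
    using s by (simp add: f_def tilted_density_def prob_powr_def Z_def chernoff_sum_def p_def q_def)
  have f1: "(\<Sum>y\<in>UNIV. f y) = 1"
    using Z0 by (simp add: f flip: sum_divide_distrib) (simp add: Z_def chernoff_sum_def p_def q_def)
  have f0: "0 \<le> f y" for y using Z0 by (simp add: f)
  have supp: "0 < p y \<and> 0 < q y" if "f y \<noteq> 0" for y
    using that pq[of y] by (auto simp: f less_le)
  define t where "t = (\<Sum>y\<in>UNIV. f y * (log 2 (q y) - log 2 (p y)))"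
  have lf: "log 2 (f y) = (1 - s) * log 2 (p y) + s * log 2 (q y) - log 2 Z" if "f y \<noteq> 0" for y
    using supp[OF that] Z0 by (simp add: f log_mult log_divide log_powr)
  have "(\<Sum>y\<in>UNIV. f y * log 2 (f y / p y)) = (\<Sum>y\<in>UNIV. s * (f y * (log 2 (q y) - log 2 (p y))) - f y * log 2 Z)"
  proof (intro sum.cong refl)
    fix y
    show "f y * log 2 (f y / p y) = s * (f y * (log 2 (q y) - log 2 (p y))) - f y * log 2 Z"
    proof (cases "f y = 0")
      case False
      then have lg: "log 2 (f y / p y) = log 2 (f y) - log 2 (p y)"
        using supp[OF False] False f0[of y] by (simp add: log_divide)
      show ?thesis unfolding lg lf[OF False] by (simp add: algebra_simps)
    qed simp
  qed
  also have "\<dots> = s * t - log 2 Z"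
    by (simp add: sum_subtractf t_def f1 flip: sum_distrib_left sum_distrib_right)
  finally have 1: "(\<Sum>y\<in>UNIV. f y * log 2 (f y / p y)) = s * t - log 2 Z" .
  have "(\<Sum>y\<in>UNIV. f y * log 2 (f y / q y)) =
      (\<Sum>y\<in>UNIV. - (1 - s) * (f y * (log 2 (q y) - log 2 (p y))) - f y * log 2 Z)"
  proof (intro sum.cong refl)
    fix y
    show "f y * log 2 (f y / q y) = - (1 - s) * (f y * (log 2 (q y) - log 2 (p y))) - f y * log 2 Z"
    proof (cases "f y = 0")
      case False
      then have lg: "log 2 (f y / q y) = log 2 (f y) - log 2 (q y)"
        using supp[OF False] False f0[of y] by (simp add: log_divide)
      show ?thesis unfolding lg lf[OF False] by (simp add: algebra_simps)
    qed simp
  qed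
  also have "\<dots> = - (1 - s) * t - log 2 Z"
    unfolding sum_subtractf t_def by (simp add: f1 flip: sum_distrib_left sum_distrib_right)
  finally have 2: "(\<Sum>y\<in>UNIV. f y * log 2 (f y / q y)) = - (1 - s) * t - log 2 Z" .
  have kl: "kl_div (tilted P x x' s) (measure_pmf (P z)) = ereal (\<Sum>y\<in>UNIV. f y * log 2 (f y / pmf (P z) y))"
    if "\<And>y. f y \<noteq> 0 \<Longrightarrow> pmf (P z) y \<noteq> 0" for z
    unfolding tilted_def f_def[symmetric] measure_pmf_eq_density[of "P z"]
    using that by (subst kl_div_density) (auto simp: f0)
  show ?thesis
    using kl[of x] kl[of x'] supp 1 2
    by (intro exI[of _ t]) (auto simp: Z_def less_le p_def q_def)
qed

lemma kl_div_tilted_degenerate: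
  assumes "0 < s" "s < 1" "chernoff_sum P x x' s = 0"
  shows "kl_div (tilted P x x' s) (measure_pmf (P z)) = 0"
proof -
  have "tilted_density P x x' s y = 0" for y
    using assms by (simp add: tilted_density_def prob_powr_def chernoff_sum_def)
  then show ?thesis
    unfolding tilted_def measure_pmf_eq_density[of "P z"]
    by (subst kl_div_density) (auto simp: zero_ereal_def)
qed

lemma kl_div_self: "kl_div (measure_pmf p) (measure_pmf (p :: 'y::finite pmf)) = 0"
  unfolding measure_pmf_eq_density[of p]
  by (subst kl_div_density) (auto simp: zero_ereal_def intro!: sum.neutral)

lemma tilted_0: "tilted P x x' 0 = measure_pmf (P x)"
  and tilted_1: "tilted P x x' 1 = measure_pmf (P x')"
  by (simp_all add: tilted_def tilted_density_endpoints measure_pmf_eq_density)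

lemma code_prob_deterministic:
  assumes "common c = measure_pmf (return_pmf 0)" "1 \<le> M"
  shows "code_prob P c M n A =
     (\<Sum>w\<in>{1..M}. measure_pmf.prob (outputs P (enc c 0 w) n) {ys. A 0 w ys}) / real M"
  using assms unfolding code_prob_def
  by (simp add: prob_bind_pmf integral_pmf_of_set vimage_def)

text \<open>Only two stopping times occur: l if the first l outputs are acknowledged, and K l
  otherwise. Code construction is thereby reduced to two decoders and two bounds averaged over the
  messages.\<close>

lemma aflf_codeI:
  fixes P :: "'x::finite \<Rightarrow> 'y::finite pmf" and \<phi> :: "nat \<Rightarrow> 'y list \<Rightarrow> 'x"
  assumes l: "1 \<le> l" and M: "1 \<le> M" and K: "1 \<le> K" and "0 \<le> \<gamma>" "0 < \<epsilon>" "\<epsilon> < 1"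
    and d: "\<And>ys. dA ys \<in> {1..M}" "\<And>ys. dB ys \<in> {1..M}"
    and stop: "(\<Sum>w\<in>{1..M}. measure_pmf.prob (outputs P (\<phi> w) l) {ys. \<not> ack ys}) / real M
      \<le> 2 powr (- \<gamma> * real l)"
    and err: "(\<Sum>w\<in>{1..M}. measure_pmf.prob (outputs P (\<phi> w) (K * l))
      {ys. (if ack (take l ys) then dA (take l ys) else dB ys) \<noteq> w}) / real M \<le> \<epsilon>"
  shows "\<exists>c. aflf_code P l M \<gamma> K \<epsilon> c"
proof -
  \<comment> \<open>The common randomness is a point mass. At lengths where the code never stops
    \<open>dec\<close> must still return a message, which \<open>dB\<close> provides.\<close>
  define c where "c = \<lparr>common = measure_pmf (return_pmf 0), enc = (\<lambda>_. \<phi>),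
    dec = (\<lambda>_ ys. if length ys = l \<and> ack ys then dA ys else dB ys),
    halt = (\<lambda>_ ys. length ys = l \<and> ack ys \<or> length ys = K * l)\<rparr>"
  have c: "common c = measure_pmf (return_pmf 0)" "enc c = (\<lambda>_. \<phi>)"
    "dec c = (\<lambda>_ ys. if length ys = l \<and> ack ys then dA ys else dB ys)"
    "halt c = (\<lambda>_ ys. length ys = l \<and> ack ys \<or> length ys = K * l)"
    by (simp_all add: c_def)
  have lK: "l \<le> K * l" using K by simp
  have prob_le: "measure_pmf.prob (outputs P \<psi> n) A \<le> measure_pmf.prob (outputs P \<psi> n) B"
    if "\<And>ys. length ys = n \<Longrightarrow> ys \<in> A \<Longrightarrow> ys \<in> B" for \<psi> :: "'y list \<Rightarrow> 'x" and n A B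
    unfolding prob_outputs_eq_sum
    by (rule sum_mono2) (use that in \<open>auto simp: finite_subset[OF _ finite_lists_length[of n]] subset_eq\<close>)
  have "code_prob P c M l (\<lambda>u w ys. \<not> halted c u ys) \<le>
      (\<Sum>w\<in>{1..M}. measure_pmf.prob (outputs P (\<phi> w) l) {ys. \<not> ack ys}) / real M"
    unfolding code_prob_deterministic[OF c(1) M] c(2)
  proof (intro divide_right_mono sum_mono prob_le)
    fix ys assume "length ys = l" "ys \<in> {ys. \<not> halted c 0 ys}"
    then show "ys \<in> {ys. \<not> ack ys}" using l by (auto simp: halted_def c)
  qed simp
  with stop have 1: "code_prob P c M l (\<lambda>u w ys. \<not> halted c u ys) \<le> 2 powr (- \<gamma> * real l)" by simp
  have halted: "halted c 0 ys" if "length ys = K * l" for ys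
    using that l lK by (auto simp: halted_def c intro!: bexI[of _ "K * l"])
  have 2: "code_prob P c M (K * l) (\<lambda>u w ys. \<not> halted c u ys) = 0"
    unfolding code_prob_deterministic[OF c(1) M] prob_outputs_eq_sum
    by (auto simp: halted intro!: sum.neutral)
  have dec: "dec c 0 (take (stop_time c 0 ys) ys) = (if ack (take l ys) then dA (take l ys) else dB ys)"
    if ys: "length ys = K * l" for ys
  proof (cases "ack (take l ys)")
    case True
    have "stop_time c 0 ys = l"
      unfolding stop_time_def c
    proof (rule Least_equality)
      show "1 \<le> l \<and> (length (take l ys) = l \<and> ack (take l ys) \<or> length (take l ys) = K * l)"
        using True l lK ys by simp
    next
      fix n assume "1 \<le> n \<and> (length (take n ys) = l \<and> ack (take n ys) \<or> length (take n ys) = K * l)"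
      then show "l \<le> n" using lK ys by (auto simp: min_def simp del: mult_le_cancel2 split: if_splits intro: le_trans[OF lK])
    qed
    then show ?thesis using True lK ys by (simp add: c)
  next
    case False
    have "stop_time c 0 ys = K * l"
      unfolding stop_time_def c
    proof (rule Least_equality)
      show "1 \<le> K * l \<and> (length (take (K * l) ys) = l \<and> ack (take (K * l) ys) \<or> length (take (K * l) ys) = K * l)"
        using l lK ys by simp
    next
      fix n assume n: "1 \<le> n \<and> (length (take n ys) = l \<and> ack (take n ys) \<or> length (take n ys) = K * l)"
      show "K * l \<le> n"
      proof (rule ccontr)
        assume "\<not> K * l \<le> n"
        then show False using n False ys by auto
      qed
    qed
    then show ?thesis using False ys by (auto simp: c)
  qed
  have "code_prob P c M (K * l) (\<lambda>u w ys. dec c u (take (stop_time c u ys) ys) \<noteq> w) \<le>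
     (\<Sum>w\<in>{1..M}. measure_pmf.prob (outputs P (\<phi> w) (K * l))
      {ys. (if ack (take l ys) then dA (take l ys) else dB ys) \<noteq> w}) / real M"
    unfolding code_prob_deterministic[OF c(1) M] c(2)
    by (intro divide_right_mono sum_mono prob_le) (auto simp: dec)
  with err have 3: "code_prob P c M (K * l) (\<lambda>u w ys. dec c u (take (stop_time c u ys) ys) \<noteq> w) \<le> \<epsilon>" by simp
  have "prob_space (common c)" unfolding c by (rule measure_pmf.prob_space_axioms)
  then have "aflf_code P l M \<gamma> K \<epsilon> c"
    using assms 1 2 3 unfolding aflf_code_def by (auto simp: c(1,3))
  then show ?thesis by blast
qed

section \<open>Almost-fixed-length codes from block codes\<close>

text \<open>Union bounds over the phases. The bounds a and b hold after every prefix with a right or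
  a wrong decision, respectively, so e and b multiply; e' is added without the probability of
  reaching the last block code.\<close>

lemma two_phase_code:
  fixes P :: "'x::finite \<Rightarrow> 'y::finite pmf"
  assumes l: "1 \<le> l" "l = n + m" and M: "1 \<le> M" and K: "1 \<le> K" and "0 \<le> \<gamma>" "0 < \<epsilon>" "\<epsilon> < 1"
    and d: "\<And>ys. d ys \<in> {1..M}" "\<And>ys. d' ys \<in> {1..M}"
    and err: "(\<Sum>w\<in>{1..M}. measure_pmf.prob (outputs P (\<lambda>ys. cb w (length ys)) n) {ys. d ys \<noteq> w}) / real M \<le> e"
    and err': "(\<Sum>w\<in>{1..M}. measure_pmf.prob (outputs P (\<lambda>ys. cb' w (length ys)) ((K - 1) * l)) {ys. d' ys \<noteq> w})
        / real M \<le> e'"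
    and type_I: "measure_pmf.prob (outputs P (\<lambda>_. x) m) {ys. nack ys} \<le> a"
    and type_II: "measure_pmf.prob (outputs P (\<lambda>_. x') m) {ys. \<not> nack ys} \<le> b"
    and stop: "e + a \<le> 2 powr (- \<gamma> * real l)" and total: "e * b + e' \<le> \<epsilon>"
  shows "\<exists>c. aflf_code P l M \<gamma> K \<epsilon> c"
proof -
  define p where "p w = measure_pmf.prob (outputs P (\<lambda>ys. cb w (length ys)) n) {ys. d ys \<noteq> w}" for w
  define p' where "p' w = measure_pmf.prob (outputs P (\<lambda>ys. cb' w (length ys)) ((K - 1) * l)) {ys. d' ys \<noteq> w}" for w
  \<comment> \<open>The encoder goes on to the last block code whatever the test says; after an
    acknowledgement these uses lie beyond the stopping time.\<close>
  define \<phi> where "\<phi> w ys = (if length ys < n then cb w (length ys) else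
    if length ys < l then (if d (take n ys) = w then x else x') else cb' w (length ys - l))" for w ys
  define ack where "ack ys = (\<not> nack (drop n ys))" for ys
  have b0: "0 \<le> b" using type_II measure_nonneg order_trans by blast
  have Kl: "K * l = l + (K - 1) * l" using K by (cases K) auto
  have phase1: "outputs P (\<phi> w) n = outputs P (\<lambda>ys. cb w (length ys)) n" for w
    by (intro outputs_cong) (simp add: \<phi>_def)
  have phase2: "outputs P (\<lambda>zs. \<phi> w (ys @ zs)) m = outputs P (\<lambda>_. if d ys = w then x else x') m"
    if "length ys = n" for w ys
    using that l by (intro outputs_cong) (simp add: \<phi>_def)
  have phase3: "outputs P (\<lambda>zs. \<phi> w (ys @ zs)) k = outputs P (\<lambda>ys. cb' w (length ys)) k"
    if "length ys = l" for w ys k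
    using that l by (intro outputs_cong) (simp add: \<phi>_def)
  have "measure_pmf.prob (outputs P (\<phi> w) l) {ys. \<not> ack ys} \<le> p w + a" for w
  proof -
    have "measure_pmf.prob (outputs P (\<phi> w) l) {ys. \<not> ack ys} \<le>
        measure_pmf.prob (outputs P (\<phi> w) l) ({ys. take n ys \<in> {ys. d ys \<noteq> w}} \<union>
          {ys. take n ys \<in> {ys. d ys = w} \<and> drop n ys \<in> {ys. nack ys}})"
      by (intro measure_pmf.finite_measure_mono) (auto simp: ack_def)
    also have "\<dots> \<le> measure_pmf.prob (outputs P (\<phi> w) l) {ys. take n ys \<in> {ys. d ys \<noteq> w}} +
        measure_pmf.prob (outputs P (\<phi> w) l) {ys. take n ys \<in> {ys. d ys = w} \<and> drop n ys \<in> {ys. nack ys}}"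
      by (intro measure_Un_le) auto
    also have "\<dots> \<le> p w + measure_pmf.prob (outputs P (\<phi> w) n) {ys. d ys = w} * a"
      unfolding l(2) p_def phase1[symmetric] using type_I
      by (intro add_mono prob_outputs_prefix_le prob_outputs_split_le) (simp add: phase2)
    also have "\<dots> \<le> p w + 1 * a"
      using type_I by (intro add_left_mono mult_right_mono) (auto intro: order_trans[OF measure_nonneg])
    finally show ?thesis by simp
  qed
  then have "(\<Sum>w\<in>{1..M}. measure_pmf.prob (outputs P (\<phi> w) l) {ys. \<not> ack ys}) \<le> (\<Sum>w\<in>{1..M}. p w + a)"
    by (intro sum_mono)
  then have "(\<Sum>w\<in>{1..M}. measure_pmf.prob (outputs P (\<phi> w) l) {ys. \<not> ack ys}) / real M \<le> e + a"
    using err M by (simp add: p_def sum.distrib field_simps)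
  then have 1: "(\<Sum>w\<in>{1..M}. measure_pmf.prob (outputs P (\<phi> w) l) {ys. \<not> ack ys}) / real M
      \<le> 2 powr (- \<gamma> * real l)" using stop by linarith
  define dA where "dA ys = d (take n ys)" for ys
  \<comment> \<open>Discarding the first l outputs makes the error of the last block code
    independent of what happened in them.\<close>
  define dB where "dB ys = d' (drop l ys)" for ys
  have "measure_pmf.prob (outputs P (\<phi> w) (K * l))
      {ys. (if ack (take l ys) then dA (take l ys) else dB ys) \<noteq> w} \<le> p w * b + p' w" for w
  proof -
    let ?A = "{ys. take n ys \<in> {ys. d ys \<noteq> w} \<and> drop n ys \<in> {ys. \<not> nack ys}}"
    have "measure_pmf.prob (outputs P (\<phi> w) (K * l)) {ys. (if ack (take l ys) then dA (take l ys) else dB ys) \<noteq> w}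
      \<le> measure_pmf.prob (outputs P (\<phi> w) (K * l)) ({ys. take l ys \<in> ?A} \<union> {ys. drop l ys \<in> {ys. d' ys \<noteq> w}})"
      by (intro measure_pmf.finite_measure_mono) (auto simp: ack_def dA_def dB_def)
    also have "\<dots> \<le> measure_pmf.prob (outputs P (\<phi> w) (K * l)) {ys. take l ys \<in> ?A} +
        measure_pmf.prob (outputs P (\<phi> w) (K * l)) {ys. drop l ys \<in> {ys. d' ys \<noteq> w}}"
      by (intro measure_Un_le) auto
    also have "\<dots> \<le> measure_pmf.prob (outputs P (\<phi> w) l) ?A + p' w"
      unfolding Kl p'_def
      by (intro add_mono prob_outputs_prefix_le prob_outputs_suffix_le) (simp add: phase3)
    also have "measure_pmf.prob (outputs P (\<phi> w) l) ?A \<le> p w * b"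
      unfolding l(2) p_def phase1[symmetric] using type_II
      by (intro prob_outputs_split_le) (simp add: phase2)
    finally show ?thesis by simp
  qed
  then have "(\<Sum>w\<in>{1..M}. measure_pmf.prob (outputs P (\<phi> w) (K * l))
      {ys. (if ack (take l ys) then dA (take l ys) else dB ys) \<noteq> w}) / real M \<le> (\<Sum>w\<in>{1..M}. p w * b + p' w) / real M"
    by (intro divide_right_mono sum_mono) auto
  also have "\<dots> = (\<Sum>w\<in>{1..M}. p w) / real M * b + (\<Sum>w\<in>{1..M}. p' w) / real M"
    by (simp add: sum.distrib add_divide_distrib flip: sum_distrib_right)
  also have "\<dots> \<le> e * b + e'"
    using err err' b0 unfolding p_def p'_def by (intro add_mono mult_right_mono)
  also have "\<dots> \<le> \<epsilon>" by (rule total)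
  finally have 2: "(\<Sum>w\<in>{1..M}. measure_pmf.prob (outputs P (\<phi> w) (K * l))
      {ys. (if ack (take l ys) then dA (take l ys) else dB ys) \<noteq> w}) / real M \<le> \<epsilon>" .
  show ?thesis
    by (rule aflf_codeI[of l M K \<gamma> \<epsilon> dA dB P \<phi> ack]) (use assms 1 2 in \<open>auto simp: dA_def dB_def simp del: One_nat_def\<close>)
qed

text \<open>With every word acknowledged the code stops at l with certainty, so any \<gamma> \<ge> 0
  is met.\<close>

lemma fixed_length_code:
  fixes P :: "'x::finite \<Rightarrow> 'y::finite pmf"
  assumes "1 \<le> l" "1 \<le> M" and K: "1 \<le> K" and "0 \<le> \<gamma>" "0 < \<epsilon>" "\<epsilon> < 1"
    and d: "\<And>ys. d ys \<in> {1..M}"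
    and err: "(\<Sum>w\<in>{1..M}. measure_pmf.prob (outputs P (\<lambda>ys. cb w (length ys)) l) {ys. d ys \<noteq> w}) / real M \<le> \<epsilon>"
  shows "\<exists>c. aflf_code P l M \<gamma> K \<epsilon> c"
proof (rule aflf_codeI[of l M K \<gamma> \<epsilon> d d P "\<lambda>w ys. cb w (length ys)" "\<lambda>_. True"])
  have "K * l = l + (K - 1) * l" using K by (cases K) auto
  then have "(\<Sum>w\<in>{1..M}. measure_pmf.prob (outputs P (\<lambda>ys. cb w (length ys)) (K * l)) {ys. take l ys \<in> {ys. d ys \<noteq> w}}) / real M
    \<le> (\<Sum>w\<in>{1..M}. measure_pmf.prob (outputs P (\<lambda>ys. cb w (length ys)) l) {ys. d ys \<noteq> w}) / real M"
    by (simp only:) (intro divide_right_mono sum_mono prob_outputs_prefix_le, simp)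
  with err show "(\<Sum>w\<in>{1..M}. measure_pmf.prob (outputs P (\<lambda>ys. cb w (length ys)) (K * l))
      {ys. (if True then d (take l ys) else d ys) \<noteq> w}) / real M \<le> \<epsilon>" by simp
qed (use assms in \<open>auto simp del: One_nat_def\<close>)

text \<open>The block length n is kept apart from l, which fixes the number of messages, because
  each phase sends all messages in its own length. Only M - 1 competitors count, so rounding M up
  costs nothing.\<close>

lemma random_coding_rate_bound:
  fixes P :: "'x::finite \<Rightarrow> 'y::finite pmf"
  assumes \<rho>: "\<rho> \<in> {0..1}" and M: "1 \<le> M" "real M \<le> 2 powr (real l * R) + 1"
  shows "\<exists>cb d. (\<forall>ys. d ys \<in> {1..M}) \<and>
    (\<Sum>m\<in>{1..M}. measure_pmf.prob (outputs P (\<lambda>ys. cb m (length ys)) n) {ys. d ys \<noteq> m}) / real M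
      \<le> 2 powr (- (real n * gallager_E0 P \<rho> Q - real l * (\<rho> * R)))"
proof -
  have "real (M - 1) powr \<rho> \<le> (2 powr (real l * R)) powr \<rho>"
    using \<rho> M by (intro powr_mono2) (auto simp: of_nat_diff)
  then have "real (M - 1) powr \<rho> * 2 powr (- real n * gallager_E0 P \<rho> Q)
      \<le> 2 powr (real l * R * \<rho>) * 2 powr (- real n * gallager_E0 P \<rho> Q)"
    by (intro mult_right_mono) (auto simp: powr_powr)
  also have "\<dots> = 2 powr (- (real n * gallager_E0 P \<rho> Q - real l * (\<rho> * R)))"
    by (simp add: algebra_simps flip: powr_add)
  finally show ?thesis
    using random_coding_bound[OF M(1), of \<rho> P n Q] \<rho> by (meson atLeastAtMost_iff order_trans)
qed

section \<open>From codes at each large length to exponents\<close>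

definition message_count :: "nat \<Rightarrow> real \<Rightarrow> nat" where
  "message_count l R = nat \<lceil>2 powr (real l * R)\<rceil>"

lemma message_count:
  shows "1 \<le> message_count l R" "2 powr (real l * R) \<le> real (message_count l R)"
    "real (message_count l R) \<le> 2 powr (real l * R) + 1"
proof -
  have "0 < 2 powr (real l * R)" by simp
  then show "1 \<le> message_count l R" unfolding message_count_def by linarith
  show "2 powr (real l * R) \<le> real (message_count l R)" unfolding message_count_def by linarith
  have "0 \<le> 2 powr (real l * R)" by simp
  then show "real (message_count l R) \<le> 2 powr (real l * R) + 1"
    unfolding message_count_def by linarith
qed

text \<open>Always answering 1 yields exponent 0. This settles K = 1 and all nonpositive target
  exponents.\<close>

lemma E_AFLF_nonneg:
  fixes P :: "'x::finite \<Rightarrow> 'y::finite pmf"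
  assumes "1 \<le> K" "0 \<le> \<gamma>"
  shows "0 \<le> E_AFLF P R \<gamma> K"
proof -
  have "aflf_achievable P R 0 \<gamma> K"
    unfolding aflf_achievable_def
  proof (rule allI, rule impI, rule exI[of _ 1], rule conjI[OF order_refl], rule allI, rule impI)
    fix \<delta> :: real and l :: nat assume \<delta>: "0 < \<delta>" and l: "1 \<le> l"
    define M where "M = message_count l R"
    \<comment> \<open>The constant answer errs with probability at most (M - 1)/M. This \<epsilon>
      lies above that value, below 1, and stays positive for M = 1, as the code definition
      demands.\<close>
    define \<epsilon> where "\<epsilon> = 1 - 1 / (real M + 1)"
    have M: "1 \<le> M" "2 powr (real l * R) \<le> real M" by (auto simp: M_def message_count simp del: One_nat_def)
    have \<epsilon>: "0 < \<epsilon>" "\<epsilon> < 1" using M by (auto simp: \<epsilon>_def field_simps)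
    obtain x :: 'x where True by blast
    have "(\<Sum>w\<in>{1..M}. measure_pmf.prob (outputs P (\<lambda>ys. x) l) {ys. 1 \<noteq> w}) \<le>
        (\<Sum>w\<in>{1..M}. 1 - (if w = 1 then 1 else 0))"
      by (intro sum_mono) auto
    also have "\<dots> = real M - 1"
      using M unfolding sum_subtractf by (subst sum.delta) auto
    finally have "(\<Sum>w\<in>{1..M}. measure_pmf.prob (outputs P (\<lambda>ys. x) l) {ys. 1 \<noteq> w}) / real M \<le> (real M - 1) / real M"
      by (intro divide_right_mono) auto
    also have "\<dots> \<le> \<epsilon>" using M by (simp add: \<epsilon>_def field_simps)
    finally have "\<exists>c. aflf_code P l M \<gamma> K \<epsilon> c"
      using assms l M \<epsilon> by (intro fixed_length_code[where d="\<lambda>_. 1" and cb="\<lambda>_ _. x"]) auto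
    then obtain c where "aflf_code P l M \<gamma> K \<epsilon> c" ..
    moreover have "1 \<le> 2 powr (- real l * (0 - \<delta>))" using \<delta> by (intro ge_one_powr_ge_zero) auto
    ultimately show "\<exists>M \<epsilon> c. aflf_code P l M \<gamma> K \<epsilon> c \<and> 2 powr (real l * R) \<le> real M \<and> \<epsilon> \<le> 2 powr (- real l * (0 - \<delta>))"
      using M \<epsilon> by (intro exI[of _ M] exI[of _ \<epsilon>] exI[of _ c]) auto
  qed
  then have "ereal 0 \<le> E_AFLF P R \<gamma> K"
    unfolding E_AFLF_def by (intro Sup_upper) blast
  then show ?thesis by (simp add: zero_ereal_def)
qed

text \<open>A positive e keeps the error bound 2^(-l e) below 1, as a code requires; e < E is the
  slack that the \<delta> of achievability offers.\<close>

lemma E_AFLF_geI: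
  assumes "1 \<le> K" "0 \<le> \<gamma>"
    and codes: "\<And>e. 0 < e \<Longrightarrow> e < E \<Longrightarrow>
      \<forall>\<^sub>F l in sequentially. \<exists>c. aflf_code P l (message_count l R) \<gamma> K (2 powr (- (real l * e))) c"
  shows "ereal E \<le> E_AFLF P R \<gamma> K"
proof (cases "0 < E")
  case False
  then have "ereal E \<le> 0" by simp
  then show ?thesis using E_AFLF_nonneg[OF assms(1,2), of P R] by (rule order_trans)
next
  case True
  have "aflf_achievable P R E \<gamma> K"
    unfolding aflf_achievable_def
  proof (intro allI impI)
    fix \<delta> :: real assume \<delta>: "0 < \<delta>"
    \<comment> \<open>The alternative E/2 keeps e positive when \<delta> \<ge> E.\<close>
    define e where "e = max (E / 2) (E - \<delta>)"
    have e: "0 < e" "e < E" "E - \<delta> \<le> e" using True \<delta> by (auto simp: e_def)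
    from codes[OF e(1,2)] obtain l0 where l0:
      "\<And>l. l0 \<le> l \<Longrightarrow> \<exists>c. aflf_code P l (message_count l R) \<gamma> K (2 powr (- (real l * e))) c"
      by (auto simp: eventually_sequentially)
    show "\<exists>l0\<ge>1. \<forall>l\<ge>l0. \<exists>M \<epsilon> c. aflf_code P l M \<gamma> K \<epsilon> c \<and> 2 powr (real l * R) \<le> real M \<and>
        \<epsilon> \<le> 2 powr (- real l * (E - \<delta>))"
    proof (rule exI[of _ "max 1 l0"], rule conjI[OF max.cobounded1], rule allI, rule impI)
      fix l assume "max 1 l0 \<le> l"
      then obtain c where "aflf_code P l (message_count l R) \<gamma> K (2 powr (- (real l * e))) c"
        using l0[of l] by auto
      moreover have "2 powr (- (real l * e)) \<le> 2 powr (- real l * (E - \<delta>))"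
        using e by (intro powr_mono) (auto simp: mult_left_mono)
      ultimately show "\<exists>M \<epsilon> c. aflf_code P l M \<gamma> K \<epsilon> c \<and> 2 powr (real l * R) \<le> real M \<and>
        \<epsilon> \<le> 2 powr (- real l * (E - \<delta>))"
        using message_count(2)[of l R] by blast
    qed
  qed
  then show ?thesis unfolding E_AFLF_def by (intro Sup_upper) blast
qed

lemma eventually_mult_ge_1:
  assumes "0 < (d :: real)"
  shows "\<forall>\<^sub>F l in sequentially. 1 \<le> real l * d"
proof -
  have "\<forall>\<^sub>F l in sequentially. 1 / d \<le> real l"
    using filterlim_real_sequentially by (simp add: filterlim_at_top)
  then show ?thesis by eventually_elim (use assms in \<open>simp add: field_simps\<close>)
qed

text \<open>One spare bit in each exponent makes each term at most half of the target.\<close>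

lemma two_powr_add_le:
  assumes "1 \<le> real l * (a - c)" "1 \<le> real l * (b - c)"
  shows "2 powr (- (real l * a)) + 2 powr (- (real l * b)) \<le> 2 powr (- (real l * c))"
proof -
  have "2 powr (- (real l * a)) \<le> 2 powr (- (real l * c) - 1)" "2 powr (- (real l * b)) \<le> 2 powr (- (real l * c) - 1)"
    using assms by (auto intro!: powr_mono simp: algebra_simps)
  then have "2 powr (- (real l * a)) + 2 powr (- (real l * b)) \<le> 2 * 2 powr (- (real l * c) - 1)" by linarith
  also have "\<dots> = 2 powr (- (real l * c))" by (simp add: powr_diff)
  finally show ?thesis .
qed

lemma E_AFLF_ge_random_coding_exponent:
  fixes P :: "'x::finite \<Rightarrow> 'y::finite pmf"
  assumes "1 \<le> K" "0 \<le> \<gamma>"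
  shows "ereal (random_coding_exponent P R) \<le> E_AFLF P R \<gamma> K"
proof (rule E_AFLF_geI[OF assms])
  fix e assume e: "0 < e" "e < random_coding_exponent P R"
  obtain \<rho> Q where \<rho>: "\<rho> \<in> {0..1}" and E0: "e < gallager_E0 P \<rho> Q - \<rho> * R"
    by (rule less_random_coding_exponentE[OF e(2)])
  show "\<forall>\<^sub>F l in sequentially. \<exists>c. aflf_code P l (message_count l R) \<gamma> K (2 powr (- (real l * e))) c"
    using eventually_ge_at_top[of 1]
  proof eventually_elim
    case (elim l)
    obtain cb d where d: "\<And>ys. d ys \<in> {1..message_count l R}" and
      err: "(\<Sum>w\<in>{1..message_count l R}. measure_pmf.prob (outputs P (\<lambda>ys. cb w (length ys)) l) {ys. d ys \<noteq> w})
        / real (message_count l R) \<le> 2 powr (- (real l * gallager_E0 P \<rho> Q - real l * (\<rho> * R)))"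
      using random_coding_rate_bound[OF \<rho> message_count(1,3), where P=P and n=l and Q=Q] by blast
    note err
    also have "2 powr (- (real l * gallager_E0 P \<rho> Q - real l * (\<rho> * R))) \<le> 2 powr (- (real l * e))"
      using E0 by (intro powr_mono) (auto simp: mult_left_mono simp flip: right_diff_distrib)
    finally show ?case
      using elim assms e d message_count(1)
      by (intro fixed_length_code[of l _ K \<gamma> _ d P cb]) (auto simp: powr_less_one)
  qed
qed

section \<open>The two-phase scheme\<close>

text \<open>In units of l, the first phase gets \<alpha> + \<kappa>, the test at least \<beta> = 1 -
  \<alpha> - 2\<kappa>, and the last \<kappa> absorbs rounding. The exponents a, \<beta> p, a +
  \<beta> q and a' then strictly exceed \<gamma>, \<gamma>, e and e, and a large l turns each gap
  into a factor 1/2.\<close>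

lemma E_AFLF_ge_two_phase:
  fixes P :: "'x::finite \<Rightarrow> 'y::finite pmf"
  assumes R: "0 < R" and \<gamma>: "0 < \<gamma>" and K: "2 \<le> K" and \<alpha>: "0 < \<alpha>" "\<alpha> < 1"
    and h: "\<gamma> \<le> \<alpha> * random_coding_exponent P (R / \<alpha>)"
    and s: "0 < s" "s < 1" and Z: "chernoff_sum P x x' s \<noteq> 0"
    and Dp: "Dp = s * t - log 2 (chernoff_sum P x x' s)" "\<gamma> \<le> (1 - \<alpha>) * Dp"
    and Dq: "Dq = - (1 - s) * t - log 2 (chernoff_sum P x x' s)"
  shows "ereal (min (\<alpha> * random_coding_exponent P (R / \<alpha>) + (1 - \<alpha>) * Dq)
      ((real K - 1) * random_coding_exponent P (R / (real K - 1)))) \<le> E_AFLF P R \<gamma> K"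
proof (rule E_AFLF_geI)
  show "1 \<le> K" "0 \<le> \<gamma>" using K \<gamma> by auto
next
  fix e
  define A where "A = \<alpha> * random_coding_exponent P (R / \<alpha>)"
  define Z where "Z = chernoff_sum P x x' s"
  assume e: "0 < e" "e < min (\<alpha> * random_coding_exponent P (R / \<alpha>) + (1 - \<alpha>) * Dq)
      ((real K - 1) * random_coding_exponent P (R / (real K - 1)))"
  have Z0: "0 < Z"
    using Z by (auto simp: Z_def less_le chernoff_sum_def intro!: sum_nonneg)
  have eA: "e < A + (1 - \<alpha>) * Dq" using e by (simp add: A_def)
  have Dp0: "0 < Dp" using Dp(2) \<gamma> \<alpha> by (smt (verit) mult_nonneg_nonpos)
  \<comment> \<open>Raising the threshold of the test by \<open>\<eta>\<close> makes the type I exponent exceed \<open>\<gamma>\<close> strictly;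
    this pays for rounding the phase lengths and for the sum of two error terms.\<close>
  define \<eta> where "\<eta> = (A + (1 - \<alpha>) * Dq - e) / (2 * ((1 - \<alpha>) * (1 - s)))"
  have \<eta>: "0 < \<eta>" using eA \<alpha> s by (simp add: \<eta>_def)
  define p where "p = Dp + s * \<eta>"
  \<comment> \<open>A raised threshold may push the type II exponent below 0; the trivial bound 1
    then applies. With q \<ge> 0, a longer test only helps.\<close>
  define q where "q = max 0 (Dq - (1 - s) * \<eta>)"
  have p0: "0 < p" using Dp0 s \<eta> by (simp add: p_def add_pos_pos)
  have pg: "\<gamma> < (1 - \<alpha>) * p"
  proof -
    have "0 < (1 - \<alpha>) * (s * \<eta>)" using \<alpha> s \<eta> by simp
    then show ?thesis using Dp(2) by (simp add: p_def distrib_left)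
  qed
  have qe: "e < A + (1 - \<alpha>) * q"
  proof -
    \<comment> \<open>\<eta> is scaled so that the type II exponent loses exactly half of the gap
      between e and the target.\<close>
    have "(1 - \<alpha>) * ((1 - s) * \<eta>) = (A + (1 - \<alpha>) * Dq - e) / 2"
    proof -
      have "c * (X / (2 * c)) = X / 2" if "c \<noteq> 0" for c X :: real using that by simp
      from this[of "(1 - \<alpha>) * (1 - s)"] show ?thesis
        unfolding \<eta>_def using \<alpha> s by (simp only: mult.assoc [symmetric]) simp
    qed
    moreover have "e < A + (Y - X)" if "X = (A + Y - e) / 2" "e < A + Y" for X Y
      using that by argo
    ultimately have "e < A + (1 - \<alpha>) * (Dq - (1 - s) * \<eta>)"
      using eA unfolding right_diff_distrib[of "1 - \<alpha>" Dq] by blast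
    also have "\<dots> \<le> A + (1 - \<alpha>) * q"
      using \<alpha> by (intro add_left_mono mult_left_mono) (auto simp: q_def)
    finally show ?thesis .
  qed
  have "\<forall>\<^sub>F \<kappa> in at_right 0. \<gamma> < (1 - \<alpha> - 2 * \<kappa>) * p"
    by (rule order_tendstoD(1)[where y="(1 - \<alpha>) * p"]) (use pg in \<open>auto intro!: tendsto_eq_intros\<close>)
  moreover have "\<forall>\<^sub>F \<kappa> in at_right 0. e < A + (1 - \<alpha> - 2 * \<kappa>) * q"
    by (rule order_tendstoD(1)[where y="A + (1 - \<alpha>) * q"]) (use qe in \<open>auto intro!: tendsto_eq_intros\<close>)
  moreover have "\<forall>\<^sub>F \<kappa> in at_right 0. 0 < 1 - \<alpha> - 2 * \<kappa>"
    by (rule order_tendstoD(1)[where y="1 - \<alpha>"]) (use \<alpha> in \<open>auto intro!: tendsto_eq_intros\<close>)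
  moreover have "\<forall>\<^sub>F \<kappa> in at_right 0. (0::real) < \<kappa>" by (rule eventually_at_right_less)
  ultimately have "\<forall>\<^sub>F \<kappa> in at_right 0. \<gamma> < (1 - \<alpha> - 2 * \<kappa>) * p \<and> e < A + (1 - \<alpha> - 2 * \<kappa>) * q
      \<and> 0 < 1 - \<alpha> - 2 * \<kappa> \<and> 0 < \<kappa>"
    by eventually_elim auto
  \<comment> \<open>The three inequalities are strict at \<kappa> = 0, so they survive for small
    positive \<kappa>.\<close>
  from eventually_happens'[OF _ this] obtain \<kappa> where \<kappa>: "\<gamma> < (1 - \<alpha> - 2 * \<kappa>) * p"
    "e < A + (1 - \<alpha> - 2 * \<kappa>) * q" "0 < 1 - \<alpha> - 2 * \<kappa>" "0 < \<kappa>" by auto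
  define \<beta> where "\<beta> = 1 - \<alpha> - 2 * \<kappa>"
  have Er: "0 < random_coding_exponent P (R / \<alpha>)"
    using h \<gamma> \<alpha> by (smt (verit) mult_nonneg_nonpos)
  \<comment> \<open>Lengthening the first phase gains strictly, since \<gamma> > 0 makes its
    exponent positive. Equality in \<open>h\<close> thereby becomes a strict inequality.\<close>
  have "A < (\<alpha> + \<kappa>) * random_coding_exponent P (R / (\<alpha> + \<kappa>))"
  proof -
    have "A < (\<alpha> + \<kappa>) * random_coding_exponent P (R / \<alpha>)"
      using Er \<kappa> by (simp add: A_def)
    also have "\<dots> \<le> (\<alpha> + \<kappa>) * random_coding_exponent P (R / (\<alpha> + \<kappa>))"
      using \<alpha> \<kappa> R by (intro mult_left_mono random_coding_exponent_antimono divide_left_mono) auto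
    finally show ?thesis .
  qed
  \<comment> \<open>One pair \<rho>, Q must serve both the stopping bound (\<gamma>) and the error
    bound (e - \<beta> q), hence the maximum.\<close>
  then have "max \<gamma> (e - \<beta> * q) < (\<alpha> + \<kappa>) * random_coding_exponent P (R / (\<alpha> + \<kappa>))"
    using h \<kappa> by (simp add: A_def \<beta>_def)
  then have "max \<gamma> (e - \<beta> * q) / (\<alpha> + \<kappa>) < random_coding_exponent P (R / (\<alpha> + \<kappa>))"
    using \<alpha> \<kappa> by (simp add: pos_divide_less_eq mult.commute)
  then obtain \<rho> Q where \<rho>: "\<rho> \<in> {0..1}"
    and "max \<gamma> (e - \<beta> * q) / (\<alpha> + \<kappa>) < gallager_E0 P \<rho> Q - \<rho> * (R / (\<alpha> + \<kappa>))"
    by (rule less_random_coding_exponentE)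
  then have "max \<gamma> (e - \<beta> * q) < (\<alpha> + \<kappa>) * (gallager_E0 P \<rho> Q - \<rho> * (R / (\<alpha> + \<kappa>)))"
    using \<alpha> \<kappa> by (simp add: pos_divide_less_eq mult.commute)
  also have "\<dots> = (\<alpha> + \<kappa>) * gallager_E0 P \<rho> Q - \<rho> * R"
    using \<alpha> \<kappa> by (simp add: right_diff_distrib)
  finally have max_less: "max \<gamma> (e - \<beta> * q) < (\<alpha> + \<kappa>) * gallager_E0 P \<rho> Q - \<rho> * R" .
  define a where "a = (\<alpha> + \<kappa>) * gallager_E0 P \<rho> Q - \<rho> * R"
  have a: "\<gamma> < a" "e < a + \<beta> * q" using max_less by (auto simp: a_def)
  have "e / (real K - 1) < random_coding_exponent P (R / (real K - 1))"
    using e K by (simp add: pos_divide_less_eq mult.commute)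
  then obtain \<rho>' Q' where \<rho>': "\<rho>' \<in> {0..1}"
    and "e / (real K - 1) < gallager_E0 P \<rho>' Q' - \<rho>' * (R / (real K - 1))"
    by (rule less_random_coding_exponentE)
  then have "e < (real K - 1) * (gallager_E0 P \<rho>' Q' - \<rho>' * (R / (real K - 1)))"
    using K by (simp add: pos_divide_less_eq mult.commute)
  also have "\<dots> = (real K - 1) * gallager_E0 P \<rho>' Q' - \<rho>' * R"
    using K by (simp add: right_diff_distrib)
  finally have e_less: "e < (real K - 1) * gallager_E0 P \<rho>' Q' - \<rho>' * R" .
  define a' where "a' = (real K - 1) * gallager_E0 P \<rho>' Q' - \<rho>' * R"
  have a': "e < a'" using e_less by (simp add: a'_def)
  have \<beta>: "0 < \<beta>" "\<gamma> < \<beta> * p" using \<kappa> by (auto simp: \<beta>_def)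
  show "\<forall>\<^sub>F l in sequentially. \<exists>c. aflf_code P l (message_count l R) \<gamma> K (2 powr (- (real l * e))) c"
    using eventually_ge_at_top[of 1] eventually_mult_ge_1[OF \<kappa>(4)]
      eventually_mult_ge_1[OF a(1)[THEN diff_gt_0_iff_gt[THEN iffD2]]]
      eventually_mult_ge_1[OF \<beta>(2)[THEN diff_gt_0_iff_gt[THEN iffD2]]]
      eventually_mult_ge_1[OF a(2)[THEN diff_gt_0_iff_gt[THEN iffD2]]]
      eventually_mult_ge_1[OF a'[THEN diff_gt_0_iff_gt[THEN iffD2]]]
  proof eventually_elim
    case large: (elim l)
    define M where "M = message_count l R"
    define n where "n = nat \<lceil>(\<alpha> + \<kappa>) * real l\<rceil>"
    define m where "m = l - n"
    have n_ge: "(\<alpha> + \<kappa>) * real l \<le> real n" unfolding n_def by linarith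
    have "0 \<le> (\<alpha> + \<kappa>) * real l" using \<alpha> \<kappa> by simp
    then have "real n \<le> (\<alpha> + \<kappa>) * real l + 1" unfolding n_def by linarith
    \<comment> \<open>Here 1 - \<beta> = \<alpha> + 2\<kappa>, and l \<kappa> \<ge> 1 pays for the
      ceiling in n.\<close>
    also have "\<dots> \<le> (1 - \<beta>) * real l" using large(2) by (simp add: \<beta>_def algebra_simps)
    finally have n_le: "real n \<le> real l - \<beta> * real l" by (simp add: algebra_simps)
    have "0 \<le> \<beta> * real l" using \<beta> by simp
    then have "real n \<le> real l" using n_le by linarith
    then have nl: "n \<le> l" by simp
    have m_ge: "real l * \<beta> \<le> real m"
      using nl n_le by (simp add: m_def of_nat_diff mult.commute)
    obtain cb d where d: "\<And>ys. d ys \<in> {1..M}" and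
      err: "(\<Sum>w\<in>{1..M}. measure_pmf.prob (outputs P (\<lambda>ys. cb w (length ys)) n) {ys. d ys \<noteq> w})
        / real M \<le> 2 powr (- (real n * gallager_E0 P \<rho> Q - real l * (\<rho> * R)))"
      using random_coding_rate_bound[OF \<rho> message_count(1,3), where P=P and n=n and Q=Q] unfolding M_def by blast
    note err
    also have "2 powr (- (real n * gallager_E0 P \<rho> Q - real l * (\<rho> * R))) \<le> 2 powr (- (real l * a))"
    proof (intro powr_mono le_imp_neg_le)
      have "real l * a = (\<alpha> + \<kappa>) * real l * gallager_E0 P \<rho> Q - real l * (\<rho> * R)"
        by (simp add: a_def algebra_simps)
      \<comment> \<open>Rounding n up can only help because E_0 is nonnegative.\<close>
      also have "\<dots> \<le> real n * gallager_E0 P \<rho> Q - real l * (\<rho> * R)"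
        using n_ge gallager_E0_nonneg[of \<rho> P Q] \<rho> by (intro diff_right_mono mult_right_mono) auto
      finally show "real l * a \<le> real n * gallager_E0 P \<rho> Q - real l * (\<rho> * R)" .
    qed simp
    finally have err: "(\<Sum>w\<in>{1..M}. measure_pmf.prob (outputs P (\<lambda>ys. cb w (length ys)) n) {ys. d ys \<noteq> w})
        / real M \<le> 2 powr (- (real l * a))" .
    obtain cb' d' where d': "\<And>ys. d' ys \<in> {1..M}" and
      err': "(\<Sum>w\<in>{1..M}. measure_pmf.prob (outputs P (\<lambda>ys. cb' w (length ys)) ((K - 1) * l)) {ys. d' ys \<noteq> w})
        / real M \<le> 2 powr (- (real ((K - 1) * l) * gallager_E0 P \<rho>' Q' - real l * (\<rho>' * R)))"
      using random_coding_rate_bound[OF \<rho>' message_count(1,3), where P=P and n="(K - 1) * l" and Q=Q'] unfolding M_def by blast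
    have "real ((K - 1) * l) * gallager_E0 P \<rho>' Q' - real l * (\<rho>' * R) = real l * a'"
      using K by (simp add: a'_def of_nat_diff algebra_simps)
    with err' have err': "(\<Sum>w\<in>{1..M}. measure_pmf.prob (outputs P (\<lambda>ys. cb' w (length ys)) ((K - 1) * l)) {ys. d' ys \<noteq> w})
        / real M \<le> 2 powr (- (real l * a'))" by (simp only:)
    define nack where "nack = likelihood_ratio_test P x x' (t + \<eta>)"
    have power: "(2 powr u) ^ k = 2 powr (real k * u)" for u :: real and k
      by (simp add: powr_powr mult.commute flip: powr_realpow)
    have Z_eq: "Z = 2 powr log 2 Z" using Z0 by simp
    have "measure_pmf.prob (outputs P (\<lambda>_. x) m) {ys. nack ys} \<le> (2 powr (- (t + \<eta>) * s) * Z) ^ m"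
      unfolding nack_def Z_def by (rule likelihood_ratio_test_type_I[OF s])
    also have "2 powr (- (t + \<eta>) * s) * Z = 2 powr (- p)"
      by (subst Z_eq) (simp add: p_def Dp Z_def algebra_simps flip: powr_add)
    also have "(2 powr (- p)) ^ m = 2 powr (- (real m * p))"
      unfolding power mult_minus_right ..
    also have "\<dots> \<le> 2 powr (- (real l * (\<beta> * p)))"
      using mult_right_mono[OF m_ge, of p] p0 by (intro powr_mono) (auto simp: mult_ac)
    finally have type_I: "measure_pmf.prob (outputs P (\<lambda>_. x) m) {ys. nack ys} \<le> 2 powr (- (real l * (\<beta> * p)))" .
    have "measure_pmf.prob (outputs P (\<lambda>_. x') m) {ys. \<not> nack ys} \<le> (2 powr ((t + \<eta>) * (1 - s)) * Z) ^ m"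
      unfolding nack_def Z_def by (rule likelihood_ratio_test_type_II[OF s])
    also have "2 powr ((t + \<eta>) * (1 - s)) * Z = 2 powr (- (Dq - (1 - s) * \<eta>))"
      by (subst Z_eq) (simp add: Dq Z_def algebra_simps flip: powr_add)
    also have "(2 powr (- (Dq - (1 - s) * \<eta>))) ^ m = 2 powr (- (real m * (Dq - (1 - s) * \<eta>)))"
      unfolding power mult_minus_right ..
    finally have "measure_pmf.prob (outputs P (\<lambda>_. x') m) {ys. \<not> nack ys} \<le> 2 powr (- (real m * q))"
      by (cases "0 \<le> Dq - (1 - s) * \<eta>") (simp_all add: q_def max_def)
    also have "\<dots> \<le> 2 powr (- (real l * (\<beta> * q)))"
      using mult_right_mono[OF m_ge, of q] by (intro powr_mono) (auto simp: mult_ac q_def)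
    finally have type_II: "measure_pmf.prob (outputs P (\<lambda>_. x') m) {ys. \<not> nack ys} \<le> 2 powr (- (real l * (\<beta> * q)))" .
    have stop: "2 powr (- (real l * a)) + 2 powr (- (real l * (\<beta> * p))) \<le> 2 powr (- \<gamma> * real l)"
      using two_powr_add_le[OF large(3,4)] by (simp add: mult.commute)
    have total: "2 powr (- (real l * a)) * 2 powr (- (real l * (\<beta> * q))) + 2 powr (- (real l * a')) \<le> 2 powr (- (real l * e))"
      using two_powr_add_le[OF large(5,6)] by (simp add: distrib_left flip: powr_add)
    have "0 < real l * e" using large(1) e by simp
    then have "2 powr (- (real l * e)) < 1" by (simp add: powr_less_one)
    then show ?case
      using two_phase_code[of l n m M K \<gamma> "2 powr (- (real l * e))" d d' P cb _ cb' _ x nack _ x',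
          OF large(1) _ _ _ _ _ _ d d' err err' type_I type_II stop total]
        message_count(1)[of l R] K \<gamma> nl by (simp add: M_def m_def)
  qed
qed

text \<open>One admissible pair \<alpha>, s at a time. The endpoints of s are treated apart: s = 0
  makes the constrained divergence 0, contradicting \<gamma> > 0, while at s = 1 that divergence may
  be infinite but the one in the objective is 0.\<close>

lemma E_AFLF_ge_E_ee'':
  fixes P :: "'x::finite \<Rightarrow> 'y::finite pmf"
  assumes R: "0 < R" "R < capacity P" and \<gamma>: "0 < \<gamma>" "\<gamma> < random_coding_exponent P R" and K: "1 \<le> K"
    and \<alpha>: "alpha_star P R \<gamma> \<le> \<alpha>" "\<alpha> \<le> 1" and s: "s \<in> {0..1}"
    and constraint: "ereal \<gamma> \<le> ereal (1 - \<alpha>) * kl_div (tilted P x x' s) (measure_pmf (P x))"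
  shows "min (E_ee'' P x x' \<alpha> s R) (ereal ((real K - 1) * random_coding_exponent P (R / (real K - 1))))
    \<le> E_AFLF P R \<gamma> K"
proof -
  have \<alpha>0: "0 < \<alpha>" using alpha_star(1)[OF R \<gamma>] \<alpha> by simp
  have fixed: "ereal (random_coding_exponent P R) \<le> E_AFLF P R \<gamma> K"
    using K \<gamma> by (intro E_AFLF_ge_random_coding_exponent) auto
  consider "K = 1" | "s = 0" | "s = 1" | "2 \<le> K" "0 < s" "s < 1" using K s by fastforce
  then show ?thesis
  proof cases
    case 1
    \<comment> \<open>The factor 0 removes the term whose rate is a division by 0, in agreement with
      its reading as 0.\<close>
    then have "ereal ((real K - 1) * random_coding_exponent P (R / (real K - 1))) = 0" by simp
    also have "0 \<le> E_AFLF P R \<gamma> K" using K \<gamma> by (intro E_AFLF_nonneg) auto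
    finally show ?thesis by (rule min.coboundedI2)
  next
    case 2
    then show ?thesis using constraint \<gamma> by (simp add: tilted_0 kl_div_self)
  next
    case 3
    have "\<alpha> * random_coding_exponent P (R / \<alpha>) \<le> 1 * random_coding_exponent P R"
      using \<alpha> \<alpha>0 R
      by (intro mult_mono random_coding_exponent_antimono random_coding_exponent_nonneg) (auto simp: field_simps)
    then have "E_ee'' P x x' \<alpha> s R \<le> ereal (random_coding_exponent P R)"
      using 3 by (simp add: E_ee''_def tilted_1 kl_div_self)
    with fixed show ?thesis by (auto intro: min.coboundedI1 order_trans)
  next
    case 4
    have Z: "chernoff_sum P x x' s \<noteq> 0"
      using kl_div_tilted_degenerate[OF 4(2,3), of P x x' x] constraint \<gamma> by auto
    obtain t where t: "kl_div (tilted P x x' s) (measure_pmf (P x)) = ereal (s * t - log 2 (chernoff_sum P x x' s))"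
      "kl_div (tilted P x x' s) (measure_pmf (P x')) = ereal (- (1 - s) * t - log 2 (chernoff_sum P x x' s))"
      using kl_div_tilted[OF 4(2,3) Z] by blast
    have c: "\<gamma> \<le> (1 - \<alpha>) * (s * t - log 2 (chernoff_sum P x x' s))" using constraint by (simp add: t)
    then have \<alpha>1: "\<alpha> < 1" using \<gamma> \<alpha> by (cases "\<alpha> = 1") auto
    \<comment> \<open>As \<alpha> grows, both the factor \<alpha> and the exponent at the smaller
      rate R/\<alpha> grow.\<close>
    have "\<gamma> = alpha_star P R \<gamma> * random_coding_exponent P (R / alpha_star P R \<gamma>)"
      using alpha_star(2)[OF R \<gamma>] by simp
    also have "\<dots> \<le> \<alpha> * random_coding_exponent P (R / \<alpha>)"
      using \<alpha> \<alpha>0 R alpha_star(1)[OF R \<gamma>]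
      by (intro mult_mono random_coding_exponent_antimono random_coding_exponent_nonneg divide_left_mono) auto
    finally have h: "\<gamma> \<le> \<alpha> * random_coding_exponent P (R / \<alpha>)" .
    show ?thesis
      using E_AFLF_ge_two_phase[OF R(1) \<gamma>(1) 4(1) \<alpha>0 \<alpha>1 h 4(2,3) Z refl c refl]
      by (simp add: E_ee''_def t flip: ereal_min)
  qed
qed

theorem theorem2:
  fixes P :: "'x::finite \<Rightarrow> 'y::finite pmf" and R \<gamma> :: real and K :: nat and x x' :: 'x
  assumes "0 < R" and "R < capacity P"
    and "is_arg_max (\<lambda>(a, b). kl_div (measure_pmf (P a)) (measure_pmf (P b))) (\<lambda>_. True) (x, x')"
    and "1 \<le> K"
  shows "(0 < \<gamma> \<and> \<gamma> < random_coding_exponent P R \<longrightarrow>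
            E_AFLF P R \<gamma> K \<ge>
              min (E_ee' P x x' R \<gamma>)
                (ereal ((real K - 1) * random_coding_exponent P (R / (real K - 1))))) \<and>
         (\<gamma> > random_coding_exponent P R \<longrightarrow>
            E_AFLF P R \<gamma> K \<ge> ereal (random_coding_exponent P R))"
proof (intro conjI impI)
  assume \<gamma>: "0 < \<gamma> \<and> \<gamma> < random_coding_exponent P R"
  let ?B = "ereal ((real K - 1) * random_coding_exponent P (R / (real K - 1)))"
  show "min (E_ee' P x x' R \<gamma>) ?B \<le> E_AFLF P R \<gamma> K"
  proof (rule ccontr)
    assume "\<not> ?thesis"
    then have "E_AFLF P R \<gamma> K < E_ee' P x x' R \<gamma>" and B: "E_AFLF P R \<gamma> K < ?B"
      by (simp_all add: not_le)
    \<comment> \<open>A value strictly below a supremum in \<open>ereal\<close> is exceeded at some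
      \<alpha>, s. This covers a maximum that is not attained as well as an empty constraint set,
      whose supremum is -\<infinity>.\<close>
    then obtain \<alpha> s where "\<alpha> \<in> {alpha_star P R \<gamma>..1}"
      and "s \<in> {s \<in> {0..1}. ereal \<gamma> \<le> ereal (1 - \<alpha>) * kl_div (tilted P x x' s) (measure_pmf (P x))}"
      and "E_AFLF P R \<gamma> K < E_ee'' P x x' \<alpha> s R"
      unfolding E_ee'_def less_SUP_iff by blast
    then show False
      using E_AFLF_ge_E_ee''[OF assms(1,2), of \<gamma> K \<alpha> s x x'] \<gamma> assms(4) B
      by (auto simp: min_le_iff_disj dest: leD)
  qed
next
  assume "random_coding_exponent P R < \<gamma>"
  then show "ereal (random_coding_exponent P R) \<le> E_AFLF P R \<gamma> K"
    using random_coding_exponent_nonneg[of P R] assms(4) by (intro E_AFLF_ge_random_coding_exponent) auto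
qed

end
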